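(* Let $\{(\Delta_m,\rho_m,k_m)\}_{m=1}^\infty$ be a sequence of parameters with $\Delta_m>0$, $\rho_m\ge0$, $k_m\in\mathbb{N}$, and let $$\mathcal{E}_m=\frac{\Delta_m^2(1+2\rho_m)}{\sqrt{2k_m(1+2\rho_m)+4(1+\rho_m)^2\Delta_m^2}}.$$ Suppose that $\{\mathcal{E}_m\}_{m=1}^\infty$ is bounded away from $0$ and $\infty$. Then there exists a sequence $$\psi_m=O\!\left(\frac{1}{\sqrt{\max\{k_m,\rho_m\}}}\right)$$ such that for any $p_{\mathrm{FA}}\in(0,1)$, with $p^{(m)}_{\mathrm{MD}}=\underline{p}^{\mathrm{umm}}_{\mathrm{MD}}(p_{\mathrm{FA}},\Delta_m,\rho_m,k_m)$, there is (for each $m$) a point $(p'_{\mathrm{FA}},p'_{\mathrm{MD}})$ on the curve $$Q^{-1}(p'_{\mathrm{FA}})+Q^{-1}(p'_{\mathrm{MD}})=\mathcal{E}_m$$ satisfying $$\max\left\{|p_{\mathrm{FA}}-p'_{\mathrm{FA}}|,\ |p^{(m)}_{\mathrm{MD}}-p'_{\mathrm{MD}}|\right\}\le\psi_m.$$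
   Context: $Q$ is the tail function of the standard normal distribution, $Q^{-1}$ its inverse. $Q_{(k),\lambda}$ is the tail function ($t\mapsto P(Z>t)$) of the non-central $\chi^2$ distribution with $k$ degrees of freedom and non-centrality parameter $\lambda$, $Q^{-1}_{(k),\lambda}$ its inverse. For $\rho>0$, $$\underline{p}^{\mathrm{umm}}_{\mathrm{MD}}(p_{\mathrm{FA}},\Delta,\rho,k)=1-E\left[Q_{(k),\|\rho X+\mu\|^2}\bigl(Q^{-1}_{(k),\|\rho X\|^2}(p_{\mathrm{FA}})\bigr)\right],\quad X\sim\mathcal{N}_k(\mu,\tfrac1\rho I),$$ for any $\mu\in\mathbb{R}^k$ with $\|\mu\|=\Delta$ (the value depends on $\mu$ only through $\Delta$); for $\rho=0$ it equals $1-Q_{(k),\Delta^2}(Q^{-1}_{(k),0}(p_{\mathrm{FA}}))$. *)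

theory Defs
  imports "HOL-Probability.Probability"
begin

(* The dimension k varies along a sequence, so vectors of R^k are functions on {..<k}, with
   Euclidean norm L2_set v {..<k}; normal_vec k m s is the law N_k(m, s^2 I). *)

definition normal_vec :: "nat \<Rightarrow> (nat \<Rightarrow> real) \<Rightarrow> real \<Rightarrow> (nat \<Rightarrow> real) measure" where
  "normal_vec k \<mu> \<sigma> = (\<Pi>\<^sub>M i\<in>{..<k}. density lborel (normal_density (\<mu> i) \<sigma>))"

definition axis_vec :: "real \<Rightarrow> nat \<Rightarrow> real" where
  "axis_vec r = (\<lambda>i. if i = 0 then r else 0)"

(* The law of the sum of the squares of k independent unit-variance normals whose means have
   squared norm l. One mean vector is picked here; by noncentral_chi2_eq every other choice
   gives the same law. *)
definition noncentral_chi2 :: "nat \<Rightarrow> real \<Rightarrow> real measure" where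
  "noncentral_chi2 k l =
     distr (normal_vec k (axis_vec (sqrt l)) 1) borel (\<lambda>x. \<Sum>i<k. (x i)\<^sup>2)"

definition chi2_tail :: "nat \<Rightarrow> real \<Rightarrow> real \<Rightarrow> real" where
  "chi2_tail k l t = measure (noncentral_chi2 k l) {t<..}"

(* The tail is 1 on the negative half-line and maps {0<..} bijectively onto {0<..<1}
   (see bij_betw_chi2_tail), so only values at p in {0<..<1} are meaningful. *)
definition chi2_tail_inv :: "nat \<Rightarrow> real \<Rightarrow> real \<Rightarrow> real" where
  "chi2_tail_inv k l = inv_into {0<..} (chi2_tail k l)"

definition normal_tail :: "real \<Rightarrow> real" where
  "normal_tail t = measure std_normal_distribution {t<..}"

definition normal_tail_inv :: "real \<Rightarrow> real" where
  "normal_tail_inv = inv normal_tail"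

definition umm_pMD_at :: "real \<Rightarrow> real \<Rightarrow> nat \<Rightarrow> (nat \<Rightarrow> real) \<Rightarrow> real" where
  "umm_pMD_at p \<rho> k \<mu> =
     1 - (\<integral>x. chi2_tail k (\<Sum>i<k. (\<rho> * x i + \<mu> i)\<^sup>2) (chi2_tail_inv k (\<Sum>i<k. (\<rho> * x i)\<^sup>2) p)
            \<partial>normal_vec k \<mu> (sqrt (1 / \<rho>)))"

(* For \<rho> > 0 any mean vector of norm \<Delta> may replace axis_vec \<Delta>: see umm_pMD_eq. *)
definition umm_pMD :: "real \<Rightarrow> real \<Rightarrow> real \<Rightarrow> nat \<Rightarrow> real" where
  "umm_pMD p \<Delta> \<rho> k =
     (if \<rho> = 0 then 1 - chi2_tail k (\<Delta>\<^sup>2) (chi2_tail_inv k 0 p)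
      else umm_pMD_at p \<rho> k (axis_vec \<Delta>))"

definition eff_snr :: "real \<Rightarrow> real \<Rightarrow> nat \<Rightarrow> real" where
  "eff_snr \<Delta> \<rho> k =
     \<Delta>\<^sup>2 * (1 + 2 * \<rho>) / sqrt (2 * real k * (1 + 2 * \<rho>) + 4 * (1 + \<rho>)\<^sup>2 * \<Delta>\<^sup>2)"

abbreviation "N1 m s \<equiv> density lborel (\<lambda>x. ennreal (normal_density m s x))"

lemma lborel2_rotation:
  fixes h :: "real \<Rightarrow> real \<Rightarrow> ennreal"
  assumes [measurable]: "(\<lambda>(x, y). h x y) \<in> borel_measurable (borel \<Otimes>\<^sub>M borel)"
    and cs: "c\<^sup>2 + s\<^sup>2 = 1"
  shows "(\<integral>\<^sup>+x. \<integral>\<^sup>+y. h (c * x - s * y) (s * x + c * y) \<partial>lborel \<partial>lborel)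
       = (\<integral>\<^sup>+x. \<integral>\<^sup>+y. h x y \<partial>lborel \<partial>lborel)"
proof (cases "c = 0")
  case False
  have e: "c * x - s * ((- s / c) * x + 1 / c * v) = 1 / c * x + (- s / c) * v" for x v
  proof -
    have "c * (c * x - s * ((- s / c) * x + 1 / c * v)) = (c\<^sup>2 + s\<^sup>2) * x - s * v"
      using False by (simp add: field_simps power2_eq_square)
    also have "\<dots> = c * (1 / c * x + (- s / c) * v)" using False cs by (simp add: field_simps)
    finally show ?thesis using False by simp
  qed
  have e2: "s * x + c * ((- s / c) * x + 1 / c * v) = v" for x v
    using False by (simp add: field_simps)
  have "(\<integral>\<^sup>+y. h (c * x - s * y) (s * x + c * y) \<partial>lborel)
      = \<bar>1/c\<bar> * (\<integral>\<^sup>+v. h (1 / c * x + (- s / c) * v) v \<partial>lborel)" for x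
    using False
    by (subst nn_integral_real_affine[where c="1/c" and t="(- s / c) * x"])
       (simp_all only: e e2, simp_all)
  then have "(\<integral>\<^sup>+x. \<integral>\<^sup>+y. h (c * x - s * y) (s * x + c * y) \<partial>lborel \<partial>lborel)
      = (\<integral>\<^sup>+x. \<bar>1/c\<bar> * (\<integral>\<^sup>+v. h (1 / c * x + (- s / c) * v) v \<partial>lborel) \<partial>lborel)"
    by simp
  also have "\<dots> = \<bar>1/c\<bar> * (\<integral>\<^sup>+x. \<integral>\<^sup>+v. h (1 / c * x + (- s / c) * v) v \<partial>lborel \<partial>lborel)"
    by (rule nn_integral_cmult) measurable
  also have "(\<integral>\<^sup>+x. \<integral>\<^sup>+v. h (1 / c * x + (- s / c) * v) v \<partial>lborel \<partial>lborel)
      = (\<integral>\<^sup>+v. \<integral>\<^sup>+x. h (1 / c * x + (- s / c) * v) v \<partial>lborel \<partial>lborel)"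
    by (rule lborel_pair.Fubini'[symmetric]) measurable
  also have "\<bar>1/c\<bar> * \<dots> = (\<integral>\<^sup>+v. \<bar>1/c\<bar> * (\<integral>\<^sup>+x. h (1 / c * x + (- s / c) * v) v \<partial>lborel) \<partial>lborel)"
    by (rule nn_integral_cmult[symmetric]) measurable
  also have "\<dots> = (\<integral>\<^sup>+v. \<integral>\<^sup>+x. h x v \<partial>lborel \<partial>lborel)"
  proof (rule nn_integral_cong)
    fix v
    show "\<bar>1/c\<bar> * (\<integral>\<^sup>+x. h (1 / c * x + (- s / c) * v) v \<partial>lborel) = (\<integral>\<^sup>+x. h x v \<partial>lborel)"
      using False
      by (subst (2) nn_integral_real_affine[where c="1/c" and t="(- s / c) * v"])
         (simp_all add: add.commute)
  qed
  also have "\<dots> = (\<integral>\<^sup>+x. \<integral>\<^sup>+y. h x y \<partial>lborel \<partial>lborel)"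
    by (rule lborel_pair.Fubini') measurable
  finally show ?thesis .
next
  case True
  then have s: "\<bar>s\<bar> = 1" "s \<noteq> 0" using cs by (auto simp: power2_eq_1_iff)
  have "(\<integral>\<^sup>+x. \<integral>\<^sup>+y. h (- s * y) (s * x) \<partial>lborel \<partial>lborel)
      = (\<integral>\<^sup>+x. \<integral>\<^sup>+y. h y (s * x) \<partial>lborel \<partial>lborel)"
    using s nn_integral_real_affine[where c="- s" and t=0 and f="\<lambda>y. h y (s * x)" for x]
    by simp
  also have "\<dots> = (\<integral>\<^sup>+y. \<integral>\<^sup>+x. h y (s * x) \<partial>lborel \<partial>lborel)"
    by (rule lborel_pair.Fubini'[symmetric]) measurable
  also have "\<dots> = (\<integral>\<^sup>+y. \<integral>\<^sup>+x. h y x \<partial>lborel \<partial>lborel)"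
    using s nn_integral_real_affine[where c="s" and t=0 and f="\<lambda>x. h y x" for y]
    by simp
  finally show ?thesis using True by simp
qed

lemma normal2_rotation:
  fixes f :: "real \<Rightarrow> real \<Rightarrow> ennreal" and b c \<sigma> :: real
  assumes [measurable]: "(\<lambda>(x, y). f x y) \<in> borel_measurable (borel \<Otimes>\<^sub>M borel)" and "\<sigma> > 0"
  defines "r \<equiv> sqrt (b\<^sup>2 + c\<^sup>2)"
  shows "(\<integral>\<^sup>+x. \<integral>\<^sup>+y. f (b * x + c * y) (x\<^sup>2 + y\<^sup>2) \<partial>N1 c \<sigma> \<partial>N1 b \<sigma>)
       = (\<integral>\<^sup>+x. \<integral>\<^sup>+y. f (r * x) (x\<^sup>2 + y\<^sup>2) \<partial>N1 0 \<sigma> \<partial>N1 r \<sigma>)"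
proof (cases "r = 0")
  case True
  then have "b = 0" "c = 0" by (auto simp: r_def)
  then show ?thesis using True by simp
next
  case False
  have r2: "r\<^sup>2 = b\<^sup>2 + c\<^sup>2" by (simp add: r_def)
  define d where "d = (\<lambda>u v. (1 / sqrt (2 * pi * \<sigma>\<^sup>2))\<^sup>2 * exp (- (v - 2 * u + r\<^sup>2) / (2 * \<sigma>\<^sup>2)))"
  define F where "F = (\<lambda>u v. ennreal (d u v) * f u v)"
  have [measurable]: "(\<lambda>(x, y). F x y) \<in> borel_measurable (borel \<Otimes>\<^sub>M borel)"
    unfolding F_def d_def by measurable
  have dens: "normal_density b' \<sigma> x * normal_density c' \<sigma> y = d (b' * x + c' * y) (x\<^sup>2 + y\<^sup>2)"
    if "b'\<^sup>2 + c'\<^sup>2 = r\<^sup>2" for b' c' x y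
    unfolding normal_density_def d_def that[symmetric] using \<open>\<sigma> > 0\<close>
    by (simp add: mult_exp_exp power2_eq_square divide_simps) (simp add: algebra_simps)
  have red: "(\<integral>\<^sup>+x. \<integral>\<^sup>+y. f (b' * x + c' * y) (x\<^sup>2 + y\<^sup>2) \<partial>N1 c' \<sigma> \<partial>N1 b' \<sigma>)
      = (\<integral>\<^sup>+x. \<integral>\<^sup>+y. F (b' * x + c' * y) (x\<^sup>2 + y\<^sup>2) \<partial>lborel \<partial>lborel)"
    if bc: "b'\<^sup>2 + c'\<^sup>2 = r\<^sup>2" for b' c'
  proof -
    have "(\<integral>\<^sup>+x. \<integral>\<^sup>+y. f (b' * x + c' * y) (x\<^sup>2 + y\<^sup>2) \<partial>N1 c' \<sigma> \<partial>N1 b' \<sigma>)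
      = (\<integral>\<^sup>+x. normal_density b' \<sigma> x * (\<integral>\<^sup>+y. normal_density c' \<sigma> y * f (b' * x + c' * y) (x\<^sup>2 + y\<^sup>2) \<partial>lborel) \<partial>lborel)"
      by (simp add: nn_integral_density)
    also have "\<dots> = (\<integral>\<^sup>+x. \<integral>\<^sup>+y. F (b' * x + c' * y) (x\<^sup>2 + y\<^sup>2) \<partial>lborel \<partial>lborel)"
    proof (rule nn_integral_cong)
      fix x
      have "normal_density b' \<sigma> x * (\<integral>\<^sup>+y. normal_density c' \<sigma> y * f (b' * x + c' * y) (x\<^sup>2 + y\<^sup>2) \<partial>lborel)
        = (\<integral>\<^sup>+y. normal_density b' \<sigma> x * (normal_density c' \<sigma> y * f (b' * x + c' * y) (x\<^sup>2 + y\<^sup>2)) \<partial>lborel)"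
        by (rule nn_integral_cmult[symmetric]) measurable
      also have "\<dots> = (\<integral>\<^sup>+y. F (b' * x + c' * y) (x\<^sup>2 + y\<^sup>2) \<partial>lborel)"
        by (rule nn_integral_cong)
           (simp add: F_def dens[OF bc, symmetric] ennreal_mult mult.assoc)
      finally show "normal_density b' \<sigma> x * (\<integral>\<^sup>+y. normal_density c' \<sigma> y * f (b' * x + c' * y) (x\<^sup>2 + y\<^sup>2) \<partial>lborel)
        = (\<integral>\<^sup>+y. F (b' * x + c' * y) (x\<^sup>2 + y\<^sup>2) \<partial>lborel)" .
    qed
    finally show ?thesis .
  qed
  define C S where "C = b / r" and "S = - c / r"
  have CS: "C\<^sup>2 + S\<^sup>2 = 1"
    using False by (simp add: C_def S_def power_divide r2[symmetric] add_divide_distrib[symmetric])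
  have bc: "b = r * C" "c = - r * S" using False by (auto simp: C_def S_def)
  have sq: "(C * x - S * y)\<^sup>2 + (S * x + C * y)\<^sup>2 = x\<^sup>2 + y\<^sup>2" for x y
  proof -
    have "(C * x - S * y)\<^sup>2 + (S * x + C * y)\<^sup>2 = (C\<^sup>2 + S\<^sup>2) * (x\<^sup>2 + y\<^sup>2)"
      by (simp add: power2_eq_square algebra_simps)
    then show ?thesis using CS by simp
  qed
  have ip: "r * (C * x - S * y) = b * x + c * y" for x y
    by (simp add: bc algebra_simps)
  have "(\<integral>\<^sup>+x. \<integral>\<^sup>+y. f (b * x + c * y) (x\<^sup>2 + y\<^sup>2) \<partial>N1 c \<sigma> \<partial>N1 b \<sigma>)
      = (\<integral>\<^sup>+x. \<integral>\<^sup>+y. F (b * x + c * y) (x\<^sup>2 + y\<^sup>2) \<partial>lborel \<partial>lborel)"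
    by (rule red) (simp add: r2)
  also have "\<dots> = (\<integral>\<^sup>+x. \<integral>\<^sup>+y. F (r * x) (x\<^sup>2 + y\<^sup>2) \<partial>lborel \<partial>lborel)"
    using lborel2_rotation[where h="\<lambda>x y. F (r * x) (x\<^sup>2 + y\<^sup>2)", OF _ CS]
    by (simp add: sq ip)
  also have "\<dots> = (\<integral>\<^sup>+x. \<integral>\<^sup>+y. f (r * x) (x\<^sup>2 + y\<^sup>2) \<partial>N1 0 \<sigma> \<partial>N1 r \<sigma>)"
    using red[of r 0] by simp
  finally show ?thesis .
qed


definition reduced_int :: "nat \<Rightarrow> real \<Rightarrow> real \<Rightarrow> (real \<Rightarrow> real \<Rightarrow> ennreal) \<Rightarrow> ennreal" where
  "reduced_int k r \<sigma> f =
     (\<integral>\<^sup>+z. \<integral>\<^sup>+x. f (r * x) (x\<^sup>2 + (\<Sum>i\<in>{1..<k}. (z i)\<^sup>2)) \<partial>N1 r \<sigma> \<partial>(\<Pi>\<^sub>M i\<in>{1..<k}. N1 0 \<sigma>))"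

lemma normal1_reflection:
  fixes f :: "real \<Rightarrow> real \<Rightarrow> ennreal"
  assumes [measurable]: "(\<lambda>(x, y). f x y) \<in> borel_measurable (borel \<Otimes>\<^sub>M borel)" and "\<sigma> > 0"
  shows "(\<integral>\<^sup>+x. f (b * x) (x\<^sup>2) \<partial>N1 b \<sigma>) = (\<integral>\<^sup>+x. f (\<bar>b\<bar> * x) (x\<^sup>2) \<partial>N1 \<bar>b\<bar> \<sigma>)"
proof (cases "b \<ge> 0")
  case False
  have e: "normal_density b \<sigma> (- x) = normal_density (- b) \<sigma> x" for x
    by (simp add: normal_density_def power2_eq_square algebra_simps)
  have "(\<integral>\<^sup>+x. normal_density b \<sigma> x * f (b * x) (x\<^sup>2) \<partial>lborel)
     = (\<integral>\<^sup>+x. normal_density (- b) \<sigma> x * f (- b * x) (x\<^sup>2) \<partial>lborel)"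
    by (subst nn_integral_real_affine[where c="-1" and t=0]) (simp_all add: e)
  then show ?thesis using False by (simp add: nn_integral_density)
qed simp

lemma product_prob_N1: "\<sigma> > 0 \<Longrightarrow> product_prob_space (\<lambda>i. N1 (v i) \<sigma>)"
  by (intro product_prob_spaceI prob_space_normal_density)

lemma normal_vec_reduce:
  fixes f :: "real \<Rightarrow> real \<Rightarrow> ennreal"
  assumes "1 \<le> k" "\<sigma> > 0"
    and "(\<lambda>(x, y). f x y) \<in> borel_measurable (borel \<Otimes>\<^sub>M borel)"
  shows "(\<integral>\<^sup>+x. f (\<Sum>i<k. v i * x i) (\<Sum>i<k. (x i)\<^sup>2) \<partial>normal_vec k v \<sigma>)
       = reduced_int k (L2_set v {..<k}) \<sigma> f"
  using assms(1,3)
proof (induction k arbitrary: f rule: nat_induct_at_least)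
  case base
  note [measurable] = base
  interpret P: product_prob_space "\<lambda>i. N1 (v i) \<sigma>" by (rule product_prob_N1[OF assms(2)])
  have "(\<integral>\<^sup>+x. f (\<Sum>i<1. v i * x i) (\<Sum>i<1. (x i)\<^sup>2) \<partial>normal_vec 1 v \<sigma>)
      = (\<integral>\<^sup>+x. (\<lambda>y. f (v 0 * y) (y\<^sup>2)) (x 0) \<partial>(\<Pi>\<^sub>M i\<in>{0}. N1 (v i) \<sigma>))"
    by (simp add: normal_vec_def lessThan_Suc)
  also have "\<dots> = (\<integral>\<^sup>+y. f (v 0 * y) (y\<^sup>2) \<partial>N1 (v 0) \<sigma>)"
    by (rule P.product_nn_integral_singleton) measurable
  also have "\<dots> = (\<integral>\<^sup>+y. f (\<bar>v 0\<bar> * y) (y\<^sup>2) \<partial>N1 \<bar>v 0\<bar> \<sigma>)"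
    by (rule normal1_reflection[OF base assms(2)])
  also have "\<dots> = reduced_int 1 (L2_set v {..<1}) \<sigma> f"
    by (simp add: reduced_int_def PiM_empty nn_integral_count_space_finite L2_set_def lessThan_Suc)
  finally show ?case by simp
next
  case (Suc k)
  note [measurable] = Suc.prems
  have P: "product_sigma_finite (\<lambda>i. N1 (u i) \<sigma>)" for u :: "nat \<Rightarrow> real"
    using product_prob_N1[OF assms(2), of u] by (simp add: product_prob_space_def)
  let ?Z = "\<Pi>\<^sub>M i\<in>{1..<k}. N1 0 \<sigma>"
  have N: "prob_space (N1 m \<sigma>)" for m by (rule prob_space_normal_density[OF assms(2)])
  have ZZ: "prob_space ?Z" by (rule prob_space_PiM) (rule N)
  have sf: "sigma_finite_measure (N1 m \<sigma>)" for m
    using N by (rule prob_space_imp_sigma_finite)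
  note [measurable (raw)] = sigma_finite_measure.borel_measurable_nn_integral[OF sf]
  have psf1: "pair_sigma_finite ?Z (N1 m \<sigma>)" for m
    using N[of m] ZZ unfolding pair_sigma_finite_def by (blast intro: prob_space_imp_sigma_finite)
  have psf2: "pair_sigma_finite (N1 m \<sigma>) (N1 m' \<sigma>)" for m m'
    using N unfolding pair_sigma_finite_def by (blast intro: prob_space_imp_sigma_finite)
  define b where "b = L2_set v {..<k}"
  define r where "r = L2_set v {..<Suc k}"
  have r: "r = sqrt (b\<^sup>2 + (v k)\<^sup>2)"
    by (simp add: r_def b_def L2_set_def sum_nonneg)
  have "(\<integral>\<^sup>+x. f (\<Sum>i<Suc k. v i * x i) (\<Sum>i<Suc k. (x i)\<^sup>2) \<partial>normal_vec (Suc k) v \<sigma>)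
      = (\<integral>\<^sup>+w. \<integral>\<^sup>+x. f ((\<Sum>i<k. v i * x i) + v k * w) ((\<Sum>i<k. (x i)\<^sup>2) + w\<^sup>2)
           \<partial>normal_vec k v \<sigma> \<partial>N1 (v k) \<sigma>)"
    unfolding normal_vec_def lessThan_Suc
    by (subst product_sigma_finite.product_nn_integral_insert_rev[OF P[of v]]) (simp_all add: add.commute)
  also have "\<dots> = (\<integral>\<^sup>+w. reduced_int k b \<sigma> (\<lambda>u s. f (u + v k * w) (s + w\<^sup>2)) \<partial>N1 (v k) \<sigma>)"
    unfolding b_def by (intro nn_integral_cong Suc.IH) measurable
  also have "\<dots> = (\<integral>\<^sup>+w. \<integral>\<^sup>+z. \<integral>\<^sup>+x. f (b * x + v k * w) (x\<^sup>2 + (\<Sum>i\<in>{1..<k}. (z i)\<^sup>2) + w\<^sup>2)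
                      \<partial>N1 b \<sigma> \<partial>?Z \<partial>N1 (v k) \<sigma>)"
    by (simp add: reduced_int_def)
  also have "\<dots> = (\<integral>\<^sup>+z. \<integral>\<^sup>+w. \<integral>\<^sup>+x. f (b * x + v k * w) (x\<^sup>2 + (\<Sum>i\<in>{1..<k}. (z i)\<^sup>2) + w\<^sup>2)
                      \<partial>N1 b \<sigma> \<partial>N1 (v k) \<sigma> \<partial>?Z)"
    by (rule pair_sigma_finite.Fubini'[OF psf1]) measurable
  also have "\<dots> = (\<integral>\<^sup>+z. \<integral>\<^sup>+x. \<integral>\<^sup>+w. f (b * x + v k * w) (x\<^sup>2 + (\<Sum>i\<in>{1..<k}. (z i)\<^sup>2) + w\<^sup>2)
                      \<partial>N1 (v k) \<sigma> \<partial>N1 b \<sigma> \<partial>?Z)"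
    by (rule nn_integral_cong, rule pair_sigma_finite.Fubini'[OF psf2]) measurable
  also have "\<dots> = (\<integral>\<^sup>+z. \<integral>\<^sup>+x. \<integral>\<^sup>+w. f (r * x) (x\<^sup>2 + (\<Sum>i\<in>{1..<k}. (z i)\<^sup>2) + w\<^sup>2)
                      \<partial>N1 0 \<sigma> \<partial>N1 r \<sigma> \<partial>?Z)"
  proof (rule nn_integral_cong)
    fix z :: "nat \<Rightarrow> real"
    show "(\<integral>\<^sup>+x. \<integral>\<^sup>+w. f (b * x + v k * w) (x\<^sup>2 + (\<Sum>i\<in>{1..<k}. (z i)\<^sup>2) + w\<^sup>2) \<partial>N1 (v k) \<sigma> \<partial>N1 b \<sigma>)
        = (\<integral>\<^sup>+x. \<integral>\<^sup>+w. f (r * x) (x\<^sup>2 + (\<Sum>i\<in>{1..<k}. (z i)\<^sup>2) + w\<^sup>2) \<partial>N1 0 \<sigma> \<partial>N1 r \<sigma>)"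
    proof -
      have e: "x\<^sup>2 + (\<Sum>i\<in>{1..<k}. (z i)\<^sup>2) + w\<^sup>2 = x\<^sup>2 + w\<^sup>2 + (\<Sum>i\<in>{1..<k}. (z i)\<^sup>2)" for x w
        by simp
      have m: "(\<lambda>(u, s). f u (s + (\<Sum>i\<in>{1..<k}. (z i)\<^sup>2))) \<in> borel_measurable (borel \<Otimes>\<^sub>M borel)"
        by measurable
      show ?thesis
        unfolding e r by (rule normal2_rotation[OF m assms(2)])
    qed
  qed
  also have "\<dots> = (\<integral>\<^sup>+z. \<integral>\<^sup>+w. \<integral>\<^sup>+x. f (r * x) (x\<^sup>2 + (\<Sum>i\<in>{1..<k}. (z i)\<^sup>2) + w\<^sup>2)
                      \<partial>N1 r \<sigma> \<partial>N1 0 \<sigma> \<partial>?Z)"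
    by (rule nn_integral_cong, rule pair_sigma_finite.Fubini'[OF psf2]) measurable
  also have "\<dots> = (\<integral>\<^sup>+w. \<integral>\<^sup>+z. \<integral>\<^sup>+x. f (r * x) (x\<^sup>2 + (\<Sum>i\<in>{1..<k}. (z i)\<^sup>2) + w\<^sup>2)
                      \<partial>N1 r \<sigma> \<partial>?Z \<partial>N1 0 \<sigma>)"
    by (rule pair_sigma_finite.Fubini'[OF psf1, symmetric]) measurable
  also have "\<dots> = reduced_int (Suc k) r \<sigma> f"
  proof -
    have "{1..<Suc k} = insert k {1..<k}" using Suc.hyps by auto
    then show ?thesis unfolding reduced_int_def
      by (simp only:) (subst product_sigma_finite.product_nn_integral_insert_rev[OF P[of "\<lambda>_. 0"]], simp_all add: add.commute add.left_commute)
  qed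
  finally show ?case by (simp add: r_def)
qed

lemma L2_set_axis_vec: "1 \<le> k \<Longrightarrow> L2_set (axis_vec r) {..<k} = \<bar>r\<bar>"
  by (simp add: L2_set_def axis_vec_def if_distrib[of "\<lambda>x. x\<^sup>2"] sum.delta' cong: if_cong)

lemma normal_vec_rotation_invariant:
  fixes f :: "real \<Rightarrow> real \<Rightarrow> ennreal"
  assumes "1 \<le> k" "\<sigma> > 0"
    and "(\<lambda>(x, y). f x y) \<in> borel_measurable (borel \<Otimes>\<^sub>M borel)"
    and "L2_set v {..<k} = L2_set w {..<k}"
  shows "(\<integral>\<^sup>+x. f (\<Sum>i<k. v i * x i) (\<Sum>i<k. (x i)\<^sup>2) \<partial>normal_vec k v \<sigma>)
       = (\<integral>\<^sup>+x. f (\<Sum>i<k. w i * x i) (\<Sum>i<k. (x i)\<^sup>2) \<partial>normal_vec k w \<sigma>)"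
  by (simp only: normal_vec_reduce[OF assms(1-3)] assms(4))

lemma sets_normal_vec [measurable_cong]: "sets (normal_vec k v s) = sets (\<Pi>\<^sub>M i\<in>{..<k}. borel)"
  unfolding normal_vec_def by (intro sets_PiM_cong) auto

lemma distr_normal_vec_rotation_invariant:
  assumes "1 \<le> k" "\<sigma> > 0" and "L2_set v {..<k} = L2_set w {..<k}"
  shows "distr (normal_vec k v \<sigma>) (borel \<Otimes>\<^sub>M borel) (\<lambda>x. (\<Sum>i<k. v i * x i, \<Sum>i<k. (x i)\<^sup>2))
       = distr (normal_vec k w \<sigma>) (borel \<Otimes>\<^sub>M borel) (\<lambda>x. (\<Sum>i<k. w i * x i, \<Sum>i<k. (x i)\<^sup>2))"
  (is "distr ?M _ ?F = distr ?N _ ?G")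
proof (rule measure_eqI)
  fix A assume "A \<in> sets (distr ?M (borel \<Otimes>\<^sub>M borel) ?F)"
  then have A[measurable]: "A \<in> sets (borel \<Otimes>\<^sub>M borel)" by simp
  have 1: "?F \<in> ?M \<rightarrow>\<^sub>M borel \<Otimes>\<^sub>M borel" "?G \<in> ?N \<rightarrow>\<^sub>M borel \<Otimes>\<^sub>M borel"
    by measurable
  have "emeasure (distr ?M (borel \<Otimes>\<^sub>M borel) ?F) A = (\<integral>\<^sup>+x. indicator A (?F x) \<partial>?M)"
    using 1 A by (subst nn_integral_indicator[symmetric], simp, subst nn_integral_distr, simp_all)
  also have "\<dots> = (\<integral>\<^sup>+x. indicator A (?G x) \<partial>?N)"
    using normal_vec_rotation_invariant[where f="\<lambda>a b. indicator A (a, b)", OF assms(1,2) _ assms(3)]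
    by simp
  also have "\<dots> = emeasure (distr ?N (borel \<Otimes>\<^sub>M borel) ?G) A"
    using 1 A by (subst nn_integral_indicator[symmetric], simp, subst nn_integral_distr, simp_all)
  finally show "emeasure (distr ?M (borel \<Otimes>\<^sub>M borel) ?F) A = emeasure (distr ?N (borel \<Otimes>\<^sub>M borel) ?G) A" .
qed simp

lemma noncentral_chi2_eq:
  assumes "1 \<le> k"
  shows "distr (normal_vec k v 1) borel (\<lambda>x. \<Sum>i<k. (x i)\<^sup>2) = noncentral_chi2 k (\<Sum>i<k. (v i)\<^sup>2)"
proof -
  have *: "distr (normal_vec k u 1) borel (\<lambda>x. \<Sum>i<k. (x i)\<^sup>2)
     = distr (distr (normal_vec k u 1) (borel \<Otimes>\<^sub>M borel) (\<lambda>x. (\<Sum>i<k. u i * x i, \<Sum>i<k. (x i)\<^sup>2))) borel snd" for u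
    by (subst distr_distr) (simp_all add: comp_def)
  have "L2_set v {..<k} = L2_set (axis_vec (sqrt (\<Sum>i<k. (v i)\<^sup>2))) {..<k}"
    using assms by (subst L2_set_axis_vec) (simp_all add: L2_set_def sum_nonneg)
  then show ?thesis
    unfolding noncentral_chi2_def *
    by (subst distr_normal_vec_rotation_invariant[OF assms zero_less_one]) (assumption, rule refl)
qed

lemma prob_space_normal_vec: "\<sigma> > 0 \<Longrightarrow> prob_space (normal_vec k v \<sigma>)"
  unfolding normal_vec_def by (rule prob_space_PiM) (rule prob_space_normal_density)

lemma real_distribution_noncentral_chi2: "real_distribution (noncentral_chi2 k l)"
proof -
  interpret prob_space "normal_vec k (axis_vec (sqrt l)) 1" by (rule prob_space_normal_vec) simp
  show ?thesis unfolding noncentral_chi2_def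
    by (rule real_distribution_distr) measurable
qed

lemma emeasure_noncentral_chi2:
  assumes "1 \<le> k" and [measurable]: "A \<in> sets borel"
  shows "emeasure (noncentral_chi2 k l) A = reduced_int k \<bar>sqrt l\<bar> 1 (\<lambda>_ s. indicator A s)"
proof -
  have "emeasure (noncentral_chi2 k l) A = (\<integral>\<^sup>+y. indicator A y \<partial>noncentral_chi2 k l)"
    by (simp add: noncentral_chi2_def)
  also have "\<dots> = (\<integral>\<^sup>+x. indicator A (\<Sum>i<k. (x i)\<^sup>2) \<partial>normal_vec k (axis_vec (sqrt l)) 1)"
    unfolding noncentral_chi2_def by (rule nn_integral_distr) measurable
  also have "\<dots> = reduced_int k (L2_set (axis_vec (sqrt l)) {..<k}) 1 (\<lambda>_ s. indicator A s)"
    by (rule normal_vec_reduce[OF assms(1)]) (simp, measurable)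
  finally show ?thesis by (simp add: L2_set_axis_vec[OF assms(1)])
qed

lemma AE_N1_neq: "AE x in N1 m 1. x\<^sup>2 + s \<noteq> t"
proof -
  have "{x. x\<^sup>2 + s = t} \<subseteq> {sqrt (t - s), - sqrt (t - s)}"
  proof
    fix x assume "x \<in> {x. x\<^sup>2 + s = t}"
    then have "t - s = x\<^sup>2" by auto
    then show "x \<in> {sqrt (t - s), - sqrt (t - s)}" by (auto simp: abs_if)
  qed
  then have "finite {x. x\<^sup>2 + s = t}" by (rule finite_subset) simp
  then have "AE x in lborel. x\<^sup>2 + s \<noteq> t"
    by (intro AE_I'[OF finite_imp_null_set_lborel]) auto
  then show ?thesis by (simp add: AE_density) (erule AE_mp, simp)
qed

lemma noncentral_chi2_null:
  assumes "1 \<le> k" "A = {t} \<or> A = {..0}"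
  shows "measure (noncentral_chi2 k l) A = 0"
proof -
  define t' where "t' = (if A = {..0} then 0 else t)"
  have [measurable]: "A \<in> sets borel" using assms(2) by auto
  have "(\<integral>\<^sup>+x. indicator A (x\<^sup>2 + (\<Sum>i\<in>{1..<k}. (z i)\<^sup>2)) \<partial>N1 \<bar>sqrt l\<bar> 1) = 0" for z :: "nat \<Rightarrow> real"
  proof -
    have "AE x in N1 \<bar>sqrt l\<bar> 1. indicator A (x\<^sup>2 + (\<Sum>i\<in>{1..<k}. (z i)\<^sup>2)) = (0::ennreal)"
      using AE_N1_neq[of "\<Sum>i\<in>{1..<k}. (z i)\<^sup>2" t']
    proof (rule AE_mp, intro AE_I2 impI)
      fix x assume ne: "x\<^sup>2 + (\<Sum>i\<in>{1..<k}. (z i)\<^sup>2) \<noteq> t'"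
      have "x\<^sup>2 + (\<Sum>i\<in>{1..<k}. (z i)\<^sup>2) \<ge> 0" by (intro add_nonneg_nonneg sum_nonneg) auto
      then show "indicator A (x\<^sup>2 + (\<Sum>i\<in>{1..<k}. (z i)\<^sup>2)) = (0::ennreal)"
        using ne assms(2) by (auto simp: t'_def indicator_def split: if_splits)
    qed
    then show ?thesis by (subst nn_integral_cong_AE[where v="\<lambda>_. 0"]) auto
  qed
  then have "emeasure (noncentral_chi2 k l) A = 0"
    by (simp add: emeasure_noncentral_chi2[OF assms(1)] reduced_int_def)
  then show ?thesis by (simp add: measure_def)
qed

lemma N1_open_pos:
  assumes "open S" "x \<in> S"
  shows "emeasure (N1 m 1) S > 0"
proof (rule ccontr)
  assume "\<not> emeasure (N1 m 1) S > 0"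
  then have "AE y in N1 m 1. y \<notin> S"
    using assms(1) by (subst AE_iff_measurable[where N=S]) auto
  then have "AE y in lborel. y \<notin> S"
    by (simp add: AE_density) (erule AE_mp, simp add: normal_density_pos)
  then have "emeasure lborel S = 0"
    using assms(1) by (subst (asm) AE_iff_measurable[where N=S]) auto
  then have "negligible S"
    using assms(1) by (simp add: negligible_iff_null_sets null_setsI null_sets_completionI)
  then show False using open_not_negligible[OF assms(1)] assms by auto
qed

lemma noncentral_chi2_pos:
  assumes k: "1 \<le> k" and tu: "0 \<le> t" "t < u"
  shows "measure (noncentral_chi2 k l) {t<..u} > 0"
proof (rule ccontr)
  interpret D: real_distribution "noncentral_chi2 k l" by (rule real_distribution_noncentral_chi2)
  let ?m = "\<bar>sqrt l\<bar>"
  let ?Z = "\<Pi>\<^sub>M i\<in>{1..<k}. N1 0 1"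
  have sf: "sigma_finite_measure (N1 m 1)" for m
    by (intro prob_space_imp_sigma_finite prob_space_normal_density) simp
  note [measurable (raw)] = sigma_finite_measure.borel_measurable_nn_integral[OF sf]
  interpret Z: product_sigma_finite "\<lambda>i::nat. N1 0 1"
    using product_prob_N1[of 1 "\<lambda>_. 0"] by (rule product_prob_space.axioms(1)) simp
  define inner where "inner = (\<lambda>z::nat \<Rightarrow> real.
      \<integral>\<^sup>+x. indicator {t<..u} (x\<^sup>2 + (\<Sum>i\<in>{1..<k}. (z i)\<^sup>2)) \<partial>N1 ?m 1)"
  have im[measurable]: "inner \<in> borel_measurable ?Z" unfolding inner_def by measurable
  assume "\<not> measure (noncentral_chi2 k l) {t<..u} > 0"
  then have "measure (noncentral_chi2 k l) {t<..u} = 0"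
    using measure_nonneg[of "noncentral_chi2 k l" "{t<..u}"] by linarith
  then have "emeasure (noncentral_chi2 k l) {t<..u} = 0"
    by (simp add: D.emeasure_eq_measure)
  then have "(\<integral>\<^sup>+z. inner z \<partial>?Z) = 0"
    by (simp add: emeasure_noncentral_chi2[OF k] reduced_int_def inner_def)
  then have ae: "AE z in ?Z. inner z = 0"
    using im by (simp only: nn_integral_0_iff_AE)
  define \<delta> where "\<delta> = sqrt (u / k)"
  have \<delta>: "\<delta> > 0" using k tu by (simp add: \<delta>_def)
  let ?B = "\<Pi>\<^sub>E i\<in>{1..<k}. {-\<delta><..<\<delta>}"
  have Bpos: "emeasure ?Z ?B > 0"
  proof -
    have "emeasure ?Z ?B = (\<Prod>i\<in>{1..<k}. emeasure (N1 0 1) {-\<delta><..<\<delta>})"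
      by (rule Z.emeasure_PiM) auto
    moreover have "emeasure (N1 0 1) {-\<delta><..<\<delta>} > 0"
      by (rule N1_open_pos[where x=0]) (use \<delta> in auto)
    ultimately show ?thesis by (simp add: zero_less_iff_neq_zero)
  qed
  have "inner z > 0" if z: "z \<in> ?B" for z
  proof -
    define s where "s = (\<Sum>i\<in>{1..<k}. (z i)\<^sup>2)"
    have "s \<le> (\<Sum>i\<in>{1..<k}. \<delta>\<^sup>2)" unfolding s_def
    proof (rule sum_mono)
      fix i assume "i \<in> {1..<k}"
      then have "z i \<in> {-\<delta><..<\<delta>}" using z by auto
      then have "\<bar>z i\<bar> \<le> \<bar>\<delta>\<bar>" by auto
      then show "(z i)\<^sup>2 \<le> \<delta>\<^sup>2" by (rule abs_le_square_iff[THEN iffD1])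
    qed
    also have "\<dots> = (real k - 1) * (u / k)" using k tu by (simp add: \<delta>_def of_nat_diff)
    also have "\<dots> < u" using k tu by (simp add: field_simps)
    finally have su: "s < u" .
    have s0: "s \<ge> 0" unfolding s_def by (simp add: sum_nonneg)
    let ?S = "{x. t < x\<^sup>2 + s \<and> x\<^sup>2 + s < u}"
    have S: "open ?S"
      by (intro open_Collect_conj open_Collect_less continuous_intros)
    have "sqrt ((max t s + u) / 2 - s) \<in> ?S"
      using su tu by (auto simp: max_def)
    then have "0 < emeasure (N1 ?m 1) ?S" by (rule N1_open_pos[OF S])
    also have "\<dots> = (\<integral>\<^sup>+x. indicator ?S x \<partial>N1 ?m 1)"
      using S by simp
    also have "\<dots> \<le> inner z"
      unfolding inner_def s_def by (intro nn_integral_mono) (auto simp: indicator_def)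
    finally show ?thesis .
  qed
  then have n: "inner z = 0 \<longrightarrow> z \<notin> ?B" for z
    by (metis less_irrefl)
  have "AE z in ?Z. z \<notin> ?B" by (rule AE_mp[OF ae]) (rule AE_I2, rule n)
  then have "emeasure ?Z ?B = 0"
    by (subst (asm) AE_iff_measurable[where N="?B"]) (auto simp: space_PiM PiE_def)
  then show False using Bpos by simp
qed

lemma chi2_tail_cdf: "chi2_tail k l t = 1 - cdf (noncentral_chi2 k l) t"
proof -
  interpret D: real_distribution "noncentral_chi2 k l" by (rule real_distribution_noncentral_chi2)
  have "{t<..} = space (noncentral_chi2 k l) - {..t}" by auto
  then show ?thesis unfolding chi2_tail_def cdf_def
    by (simp only:) (rule D.prob_compl, simp)
qed

lemma chi2_tail_strict:
  assumes "1 \<le> k" "0 \<le> t" "t < u"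
  shows "chi2_tail k l u < chi2_tail k l t"
proof -
  interpret D: real_distribution "noncentral_chi2 k l" by (rule real_distribution_noncentral_chi2)
  show ?thesis
    using noncentral_chi2_pos[OF assms, of l] D.cdf_diff_eq[OF assms(3)] by (simp add: chi2_tail_cdf)
qed

lemma chi2_tail_inv:
  assumes "1 \<le> k" "0 < p" "p < 1"
  shows "chi2_tail_inv k l p > 0" "chi2_tail k l (chi2_tail_inv k l p) = p"
proof -
  interpret D: real_distribution "noncentral_chi2 k l" by (rule real_distribution_noncentral_chi2)
  let ?F = "cdf (noncentral_chi2 k l)"
  have "?F 0 = 0" using noncentral_chi2_null[OF assms(1), of "{..0}"] by (simp add: cdf_def)
  moreover have "eventually (\<lambda>x. ?F x > 1 - p) at_top"
    using order_tendstoD(1)[OF D.cdf_lim_at_top_prob, of "1 - p"] assms by simp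
  then obtain b where b: "b > 0" "?F b > 1 - p"
    using eventually_conj[OF _ eventually_gt_at_top[of 0]] eventually_happens
    by (metis (mono_tags, lifting) trivial_limit_at_top_linorder)
  moreover have "isCont ?F x" for x
    using D.isCont_cdf noncentral_chi2_null[OF assms(1), of "{x}" x] by simp
  ultimately obtain x where x: "0 \<le> x" "?F x = 1 - p"
    using IVT[of ?F 0 "1 - p" b] assms by auto
  then have "x > 0" using \<open>?F 0 = 0\<close> assms by (cases "x = 0") auto
  then have "p \<in> chi2_tail k l ` {0<..}" using x by (auto simp: chi2_tail_cdf intro!: image_eqI[of _ _ x])
  then show "chi2_tail_inv k l p > 0" "chi2_tail k l (chi2_tail_inv k l p) = p"
    unfolding chi2_tail_inv_def using inv_into_into[of p "chi2_tail k l" "{0<..}"]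
    by (auto simp: f_inv_into_f)
qed

lemma bij_betw_chi2_tail:
  assumes "1 \<le> k"
  shows "bij_betw (chi2_tail k l) {0<..} {0<..<1}"
proof (rule bij_betwI')
  interpret D: real_distribution "noncentral_chi2 k l" by (rule real_distribution_noncentral_chi2)
  fix x y :: real
  assume x: "x \<in> {0<..}"
  show "chi2_tail k l x \<in> {0<..<1}"
    unfolding greaterThanLessThan_iff
  proof
    show "0 < chi2_tail k l x"
      using chi2_tail_strict[OF assms, of x "x + 1" l] x
      by (intro le_less_trans[of 0 "chi2_tail k l (x + 1)"]) (auto simp: chi2_tail_def)
    show "chi2_tail k l x < 1"
      using chi2_tail_strict[OF assms, of 0 x l] x
      by (intro less_le_trans[of _ "chi2_tail k l 0" 1]) (auto simp: chi2_tail_def)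
  qed
  assume y: "y \<in> {0<..}"
  show "chi2_tail k l x = chi2_tail k l y \<longleftrightarrow> x = y"
    using chi2_tail_strict[OF assms, of x y l] chi2_tail_strict[OF assms, of y x l] x y
    by (cases x y rule: linorder_cases) auto
next
  fix p :: real assume "p \<in> {0<..<1}"
  then show "\<exists>x\<in>{0<..}. p = chi2_tail k l x"
    using chi2_tail_inv[OF assms, of p l] by (intro bexI[of _ "chi2_tail_inv k l p"]) auto
qed

lemma less_chi2_tail_inv_iff:
  assumes "1 \<le> k" "0 < p" "p < 1" "0 \<le> t"
  shows "t < chi2_tail_inv k l p \<longleftrightarrow> p < chi2_tail k l t"
  using chi2_tail_inv[OF assms(1-3), of l] chi2_tail_strict[OF assms(1), of _ _ l] assms(4)
  by (metis less_asym less_le_not_le linorder_neqE not_less_iff_gr_or_eq)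

lemma borel_measurable_chi2_tail:
  assumes "1 \<le> k"
  shows "(\<lambda>(l, t). chi2_tail k l t) \<in> borel_measurable (borel \<Otimes>\<^sub>M borel)"
proof -
  interpret Z: prob_space "\<Pi>\<^sub>M i\<in>{1..<k}. N1 0 1"
    by (rule prob_space_PiM) (simp add: prob_space_normal_density)
  have "chi2_tail k l t = enn2real (\<integral>\<^sup>+z. \<integral>\<^sup>+x. ennreal (normal_density \<bar>sqrt l\<bar> 1 x) *
          of_bool (t < x\<^sup>2 + (\<Sum>i\<in>{1..<k}. (z i)\<^sup>2)) \<partial>lborel \<partial>(\<Pi>\<^sub>M i\<in>{1..<k}. N1 0 1))" for l t
    unfolding chi2_tail_def measure_def
    by (simp add: emeasure_noncentral_chi2[OF assms] reduced_int_def nn_integral_density indicator_def)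
  moreover have [measurable]: "(\<lambda>(l, x). normal_density \<bar>sqrt l\<bar> 1 x) \<in> borel_measurable (borel \<Otimes>\<^sub>M borel)"
    unfolding normal_density_def by measurable
  note [measurable (raw)] = Z.borel_measurable_nn_integral
  have "(\<lambda>(l, t). enn2real (\<integral>\<^sup>+z. \<integral>\<^sup>+x. ennreal (normal_density \<bar>sqrt l\<bar> 1 x) *
          of_bool (t < x\<^sup>2 + (\<Sum>i\<in>{1..<k}. (z i)\<^sup>2)) \<partial>lborel \<partial>(\<Pi>\<^sub>M i\<in>{1..<k}. N1 0 1)))
      \<in> borel_measurable (borel \<Otimes>\<^sub>M borel)"
    unfolding of_bool_def by measurable
  ultimately show ?thesis by (simp only:)
qed

lemma borel_measurable_chi2_tail_inv:
  assumes "1 \<le> k" "0 < p" "p < 1"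
  shows "(\<lambda>l. chi2_tail_inv k l p) \<in> borel_measurable borel"
proof (subst borel_measurable_iff_greater, intro allI)
  fix a
  note [measurable] = borel_measurable_chi2_tail[OF assms(1)]
  show "{l \<in> space borel. a < chi2_tail_inv k l p} \<in> sets borel"
  proof (cases "a \<ge> 0")
    case True
    have "{l \<in> space borel. p < chi2_tail k l a} \<in> sets borel" by measurable
    then show ?thesis by (simp add: less_chi2_tail_inv_iff[OF assms True])
  next
    case False
    then have "{l \<in> space borel. a < chi2_tail_inv k l p} = UNIV"
      using chi2_tail_inv(1)[OF assms] by (auto intro: less_trans[of a 0])
    then show ?thesis by simp
  qed
qed

lemma umm_pMD_at_cong:
  assumes k: "1 \<le> k" and p: "0 < p" "p < 1" and \<rho>: "\<rho> > 0"
    and vw: "L2_set v {..<k} = L2_set w {..<k}"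
  shows "umm_pMD_at p \<rho> k v = umm_pMD_at p \<rho> k w"
proof -
  note [measurable] = borel_measurable_chi2_tail[OF k] borel_measurable_chi2_tail_inv[OF k p]
  define N where "N = (\<Sum>i<k. (v i)\<^sup>2)"
  define G where "G = (\<lambda>(u, s). chi2_tail k (\<rho>\<^sup>2 * s + 2 * \<rho> * u + N) (chi2_tail_inv k (\<rho>\<^sup>2 * s) p))"
  have [measurable]: "G \<in> borel_measurable (borel \<Otimes>\<^sub>M borel)"
    unfolding G_def by measurable
  have sq: "sqrt (1 / \<rho>) > 0" using \<rho> by simp
  have N': "(\<Sum>i<k. (w i)\<^sup>2) = N"
    using vw by (simp add: L2_set_def N_def)
  have *: "umm_pMD_at p \<rho> k u = 1 - (\<integral>y. G y \<partial>distr (normal_vec k u (sqrt (1 / \<rho>))) (borel \<Otimes>\<^sub>M borel)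
      (\<lambda>x. (\<Sum>i<k. u i * x i, \<Sum>i<k. (x i)\<^sup>2)))" if "(\<Sum>i<k. (u i)\<^sup>2) = N" for u
  proof -
    have "(\<Sum>i<k. (\<rho> * x i + u i)\<^sup>2) = \<rho>\<^sup>2 * (\<Sum>i<k. (x i)\<^sup>2) + 2 * \<rho> * (\<Sum>i<k. u i * x i) + N" for x
      unfolding that[symmetric]
      by (simp add: sum_distrib_left sum.distrib[symmetric] power2_eq_square algebra_simps)
    moreover have "(\<Sum>i<k. (\<rho> * x i)\<^sup>2) = \<rho>\<^sup>2 * (\<Sum>i<k. (x i)\<^sup>2)" for x
      by (simp add: sum_distrib_left power_mult_distrib)
    ultimately show ?thesis
      unfolding umm_pMD_at_def by (subst integral_distr) (simp_all add: G_def)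
  qed
  show ?thesis
    unfolding *[OF N'] *[OF N_def[symmetric]]
    by (subst distr_normal_vec_rotation_invariant[OF k sq vw]) (rule refl)
qed

corollary umm_pMD_eq:
  assumes "1 \<le> k" "0 < p" "p < 1" "\<rho> > 0" "L2_set \<mu> {..<k} = \<Delta>"
  shows "umm_pMD p \<Delta> \<rho> k = umm_pMD_at p \<rho> k \<mu>"
proof -
  have "L2_set (axis_vec \<Delta>) {..<k} = L2_set \<mu> {..<k}"
    using assms(1,5) L2_set_nonneg[of \<mu> "{..<k}"] by (simp add: L2_set_axis_vec)
  then show ?thesis
    using assms umm_pMD_at_cong[OF assms(1-4), of "axis_vec \<Delta>" \<mu>] by (simp add: umm_pMD_def)
qed

end

theory Submission
  imports Defs "HOL-Real_Asymp.Real_Asymp"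
begin

text \<open>Given $X$, put $\lambda = \|\rho X\|^2$, $\lambda' = \|\rho X + \mu\|^2$, $d = \lambda' - \lambda$,
  $s^2 = 2k + 4\lambda$, $s'^2 = 2k + 4\lambda'$, and let $D$ be the denominator of \<open>eff_snr\<close>.
  Stein's method gives $|Q_{(k),\lambda}(t) - Q((t - k - \lambda)/s)| \le 3/s$: Gaussian integration by
  parts in each coordinate produces a Stein kernel that is a quadratic polynomial with mean $s^2$
  and variance at most $9 s^2$. Hence the conditional detection probability is about
  $Q((s x - d)/s')$, where $Q(x)$ is within $O(1/D)$ of $p_{\mathrm{FA}}$. Replacing $s$ and $s'$ by $D$ and
  then taking the expectation of the second-order expansion of $Q(x - d/D)$ leaves
  $Q(x - \mathcal{E})$; since $d$ and $\lambda$ are quadratic in $X$, all the errors reduce to second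
  moments, and these are $O(b)$ with $b^2 = (1 + \rho)/D^2 = O(1/\max\{k, \rho\})$. As $p_{\mathrm{FA}}$
  may be close to 0 or 1, where the curve is not Lipschitz, the point on the curve is found by the
  intermediate value theorem on the window $|Q(x) - p_{\mathrm{FA}}| \le \psi_m$.\<close>

section \<open>The standard normal tail\<close>

text \<open>\<open>eff_snr\<close> has a probabilistic meaning:
  \<open>\<Delta>\<^sup>2 * (1 + 2 * \<rho>)\<close> is the mean of d and D^2 is the mean of s'^2,
  so the limiting curve freezes shift and scale at these averages. The two fluctuations have
  different orders. That of s^2 relative to D^2 is O(b), so first-order estimates suffice for the
  scale. The shift d has standard deviation 2 sqrt(\<rho>) \<Delta>, whose ratio to D is in general
  only of order D^(-1/2); a Lipschitz bound on Q would lose half of the exponent. Hence the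
  second-order expansion about the mean shift: its linear term integrates to zero and its quadratic
  term costs 4 \<rho> \<Delta>^2 / D^2, at most 2 \<open>eff_snr\<close> / D. The normal quantile
  belonging to the threshold is itself a function of X, and it is unbounded as pFA varies.
  Monotonicity of Q allows comparison with one fixed x for all X, and the change of scale is
  estimated uniformly in the argument of Q. No constant then depends on pFA, so \<psi> can be chosen
  before it.\<close>

lemma std_normal_density_tendsto_0: "(std_normal_density \<longlongrightarrow> 0) at_top"
  unfolding std_normal_density_def by real_asymp

lemma DERIV_std_normal_density:
  "(std_normal_density has_real_derivative - x * std_normal_density x) (at x)"
  unfolding std_normal_density_def by (auto intro!: derivative_eq_intros simp: field_simps)

lemma normal_tail_cdf: "normal_tail t = 1 - cdf std_normal_distribution t"
proof -
  interpret real_distribution std_normal_distribution by (rule real_dist_normal_dist)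
  have "{t<..} = space std_normal_distribution - {..t}" by auto
  then show ?thesis unfolding normal_tail_def cdf_def
    by (simp only:) (rule prob_compl, simp)
qed

lemma normal_tail_nonneg: "0 \<le> normal_tail t"
  and normal_tail_le_1: "normal_tail t \<le> 1"
proof -
  interpret real_distribution std_normal_distribution by (rule real_dist_normal_dist)
  show "0 \<le> normal_tail t" "normal_tail t \<le> 1" by (simp_all add: normal_tail_def)
qed

lemma normal_tail_at_top: "(normal_tail \<longlongrightarrow> 0) at_top"
  and normal_tail_at_bot: "(normal_tail \<longlongrightarrow> 1) at_bot"
proof -
  interpret real_distribution std_normal_distribution by (rule real_dist_normal_dist)
  show "(normal_tail \<longlongrightarrow> 0) at_top" unfolding normal_tail_cdf[abs_def]
    using tendsto_diff[OF tendsto_const cdf_lim_at_top_prob, of 1] by simp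
  show "(normal_tail \<longlongrightarrow> 1) at_bot" unfolding normal_tail_cdf[abs_def]
    using tendsto_diff[OF tendsto_const cdf_lim_at_bot, of 1] by simp
qed

lemma DERIV_normal_tail: "(normal_tail has_real_derivative - std_normal_density x) (at x)"
proof -
  interpret real_distribution std_normal_distribution by (rule real_dist_normal_dist)
  let ?a = "x - 1" and ?b = "x + 1"
  have eq: "normal_tail y = normal_tail ?a - integral {?a..y} std_normal_density" if "y \<in> {?a<..<?b}" for y
  proof -
    have "ennreal (measure std_normal_distribution {?a<..y}) = emeasure std_normal_distribution {?a<..y}"
      by (simp add: emeasure_eq_measure)
    also have "\<dots> = (\<integral>\<^sup>+t\<in>{?a<..y}. ennreal (std_normal_density t) \<partial>lborel)"
      by (simp add: emeasure_density)
    also have "\<dots> = (\<integral>\<^sup>+t\<in>{?a..y}. ennreal (std_normal_density t) \<partial>lborel)"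
      by (rule nn_integral_cong_AE)
        (use AE_lborel_singleton[of ?a] in eventually_elim, auto simp: indicator_def)
    also have "\<dots> = ennreal (integral {?a..y} std_normal_density)"
    proof -
      have "std_normal_density integrable_on {?a..y}"
        by (intro integrable_continuous_real continuous_at_imp_continuous_on ballI
            DERIV_isCont[OF DERIV_std_normal_density])
      from nn_integral_has_integral_lebesgue[OF _ integrable_integral[OF this]]
      show ?thesis
        by (simp add: ennreal_mult mult.commute ennreal_indicator)
    qed
    finally have "measure std_normal_distribution {?a<..y} = integral {?a..y} std_normal_density"
      by (subst (asm) ennreal_inj) (auto intro!: integral_nonneg integrable_continuous_real
        continuous_at_imp_continuous_on DERIV_isCont[OF DERIV_std_normal_density])
    then show ?thesis using cdf_diff_eq[of ?a y] that by (simp add: normal_tail_cdf)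
  qed
  have "((\<lambda>y. integral {?a..y} std_normal_density) has_real_derivative std_normal_density x) (at x within {?a..?b})"
    by (intro integral_has_real_derivative continuous_at_imp_continuous_on ballI
        DERIV_isCont[OF DERIV_std_normal_density]) auto
  then have "((\<lambda>y. integral {?a..y} std_normal_density) has_real_derivative std_normal_density x) (at x)"
    by (simp add: at_within_Icc_at)
  then have "((\<lambda>y. normal_tail ?a - integral {?a..y} std_normal_density) has_real_derivative - std_normal_density x) (at x)"
    by (auto intro!: derivative_eq_intros)
  then show ?thesis
    by (rule has_field_derivative_transform_within_open[where S="{?a<..<?b}"]) (auto simp: eq)
qed

lemma isCont_normal_tail: "isCont normal_tail x"
  by (rule DERIV_isCont[OF DERIV_normal_tail])

lemma normal_tail_strict_antimono: "x < y \<Longrightarrow> normal_tail y < normal_tail x"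
  by (rule DERIV_neg_imp_decreasing) (auto intro!: exI[of _ "- std_normal_density _"]
      DERIV_normal_tail normal_density_pos)

lemma normal_tail_le_iff: "normal_tail x \<le> normal_tail y \<longleftrightarrow> y \<le> x"
  using normal_tail_strict_antimono[of x y] normal_tail_strict_antimono[of y x] by (cases x y rule: linorder_cases) auto

lemma normal_tail_bounds: "0 < normal_tail x" "normal_tail x < 1"
  using normal_tail_strict_antimono[of x "x + 1"] normal_tail_nonneg[of "x + 1"]
    normal_tail_strict_antimono[of "x - 1" x] normal_tail_le_1[of "x - 1"] by linarith+

lemma normal_tail_inv_normal_tail: "normal_tail_inv (normal_tail x) = x"
  unfolding normal_tail_inv_def
  by (rule inv_f_f) (auto intro!: injI antisym simp: normal_tail_le_iff[symmetric])

lemma normal_tail_surj: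
  assumes "0 < p" "p < 1"
  obtains x where "normal_tail x = p"
proof -
  have "eventually (\<lambda>x. normal_tail x < p) at_top"
    using order_tendstoD(2)[OF normal_tail_at_top] assms by simp
  then obtain b where b: "normal_tail b < p" by (auto simp: eventually_at_top_linorder)
  have "eventually (\<lambda>x. normal_tail x > p) at_bot"
    using order_tendstoD(1)[OF normal_tail_at_bot] assms by simp
  then obtain a where a: "normal_tail a > p" by (auto simp: eventually_at_bot_linorder)
  then have "a \<le> b" using b normal_tail_strict_antimono[of b a] by linarith
  then show ?thesis using IVT2[of normal_tail b p a] a b isCont_normal_tail that by auto
qed

text \<open>The density is even, so Q(x) + Q(-x) has derivative zero; its constant value is read off
  at infinity.\<close>

lemma normal_tail_uminus: "normal_tail (- x) = 1 - normal_tail x"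
proof -
  let ?g = "\<lambda>x. normal_tail x + normal_tail (- x)"
  have deriv: "(?g has_real_derivative 0) (at y)" for y
    using DERIV_add[OF DERIV_normal_tail[of y] DERIV_chain2[where f=normal_tail and g=uminus and x=y, OF DERIV_normal_tail[of "- y"] DERIV_minus[OF DERIV_ident]]]
    by (auto intro!: derivative_eq_intros simp: std_normal_density_def)
  define c where "c = ?g x"
  from deriv have const: "?g y = c" for y
    unfolding c_def by (rule DERIV_isconst_all[rule_format])
  have "(?g \<longlongrightarrow> 0 + 1) at_top"
    by (intro tendsto_add normal_tail_at_top filterlim_compose[OF normal_tail_at_bot] filterlim_uminus_at_bot_at_top)
  then have "c = 1" by (simp add: const tendsto_const_iff)
  then show ?thesis using const[of x] by simp
qed

section \<open>Quantitative bounds on Q and its density\<close>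

text \<open>With w frozen, the difference of the density over w and Q has derivative (1 - y/w) times
  the density, which is nonpositive for y \<ge> w, and its limit is 0.\<close>

lemma mills_ratio:
  assumes "w > 0"
  shows "w * normal_tail w \<le> std_normal_density w"
proof -
  let ?h = "\<lambda>x. std_normal_density x / w - normal_tail x"
  have "(?h \<longlongrightarrow> 0 / w - 0) at_top"
    using assms by (intro tendsto_intros std_normal_density_tendsto_0 normal_tail_at_top) auto
  moreover have "?h x \<le> ?h w" if "x \<ge> w" for x
  proof (rule DERIV_nonpos_imp_nonincreasing[OF that])
    fix y assume "w \<le> y"
    have "(?h has_real_derivative - y * std_normal_density y / w + std_normal_density y) (at y)"
      using assms by (auto intro!: derivative_eq_intros DERIV_std_normal_density DERIV_normal_tail)
    moreover have "- y * std_normal_density y / w + std_normal_density y \<le> 0"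
      using assms \<open>w \<le> y\<close> mult_right_mono[OF \<open>w \<le> y\<close>, of "std_normal_density y"] by (simp add: field_simps)
    ultimately show "\<exists>z. (?h has_real_derivative z) (at y) \<and> z \<le> 0" by blast
  qed
  then have "eventually (\<lambda>x. ?h x \<le> ?h w) at_top"
    by (rule eventually_at_top_linorderI)
  ultimately have "0 / w - 0 \<le> ?h w"
    by (intro tendsto_upperbound[of ?h _ at_top]) simp_all
  then show ?thesis using assms by (simp add: field_simps)
qed

lemma std_normal_density_le_1: "std_normal_density x \<le> 1"
  and abs_mult_std_normal_density_le_1: "\<bar>x * std_normal_density x\<bar> \<le> 1"
proof -
  have c: "0 \<le> 1 / sqrt (2 * pi)" "1 / sqrt (2 * pi) \<le> 1"
    using pi_ge_two by (auto simp: real_le_rsqrt)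
  show "std_normal_density x \<le> 1"
    unfolding std_normal_density_def using c by (intro mult_le_one) auto
  have "0 \<le> (\<bar>x\<bar> - 1)\<^sup>2" by simp
  then have "\<bar>x\<bar> \<le> 1 + x\<^sup>2 / 2" by (simp add: power2_diff)
  also have "\<dots> \<le> exp (x\<^sup>2 / 2)" by (rule exp_ge_add_one_self)
  finally have "\<bar>x\<bar> * exp (- x\<^sup>2 / 2) \<le> exp (x\<^sup>2 / 2) * exp (- x\<^sup>2 / 2)"
    by (intro mult_right_mono) auto
  also have "\<dots> = 1" by (simp flip: exp_add)
  finally have "\<bar>x\<bar> * exp (- x\<^sup>2 / 2) \<le> 1" .
  then have "1 / sqrt (2 * pi) * (\<bar>x\<bar> * exp (- x\<^sup>2 / 2)) \<le> 1"
    by (rule mult_le_one[OF c(2), rotated]) simp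
  then show "\<bar>x * std_normal_density x\<bar> \<le> 1"
    by (simp add: std_normal_density_def abs_mult)
qed

lemma normal_tail_lipschitz: "\<bar>normal_tail a - normal_tail b\<bar> \<le> \<bar>a - b\<bar>"
  using field_differentiable_bound[of UNIV normal_tail "\<lambda>x. - std_normal_density x" 1 a b]
    DERIV_normal_tail std_normal_density_le_1 by simp

lemma std_normal_density_lipschitz: "\<bar>std_normal_density a - std_normal_density b\<bar> \<le> \<bar>a - b\<bar>"
  using field_differentiable_bound[of UNIV std_normal_density "\<lambda>x. - x * std_normal_density x" 1 a b]
    DERIV_std_normal_density abs_mult_std_normal_density_le_1 by simp

lemma normal_tail_taylor: "\<bar>normal_tail (a + h) - (normal_tail a - std_normal_density a * h)\<bar> \<le> h\<^sup>2"
proof -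
  let ?f = "\<lambda>t. normal_tail (a + t) + std_normal_density a * t"
  have "norm (?f h - ?f 0) \<le> \<bar>h\<bar> * norm (h - 0)"
  proof (rule field_differentiable_bound)
    fix t assume t: "t \<in> closed_segment 0 h"
    have "((\<lambda>t. a + t) has_real_derivative 1) (at t)" by (auto intro!: derivative_eq_intros)
    from DERIV_chain2[OF DERIV_normal_tail this]
    have "(?f has_real_derivative - std_normal_density (a + t) + std_normal_density a) (at t)"
      by (auto intro!: derivative_eq_intros)
    then show "(?f has_real_derivative - std_normal_density (a + t) + std_normal_density a)
        (at t within closed_segment 0 h)"
      by (rule has_field_derivative_at_within)
    have "\<bar>t\<bar> \<le> \<bar>h\<bar>" using t by (auto simp: closed_segment_eq_real_ivl split: if_splits)
    then show "norm (- std_normal_density (a + t) + std_normal_density a) \<le> \<bar>h\<bar>"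
      using std_normal_density_lipschitz[of a "a + t"] by simp
  qed auto
  then show ?thesis by (simp add: power2_eq_square algebra_simps flip: abs_mult)
qed

text \<open>The density at x is at most 1/|x|, which makes Q Lipschitz in log |x|. A dilation of the
  argument therefore costs an amount independent of y, whereas the plain Lipschitz bound would grow
  with |y|.\<close>

lemma normal_tail_scale:
  assumes m: "0 < m" "m \<le> s" "m \<le> s'"
  shows "\<bar>normal_tail (s / s' * y) - normal_tail y\<bar> \<le> \<bar>s - s'\<bar> / m"
proof (cases "y = 0")
  case False
  define r where "r = s / s'"
  have r: "r > 0" unfolding r_def using m by simp
  \<comment> \<open>The factor is the largest value of 1/|x| on the segment from y to r y, which
    stays away from 0.\<close>
  have "norm (normal_tail (r * y) - normal_tail y) \<le> 1 / (\<bar>y\<bar> * min 1 r) * norm (r * y - y)"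
  proof (rule field_differentiable_bound)
    fix x assume "x \<in> closed_segment y (r * y)"
    then obtain t where t: "0 \<le> t" "t \<le> 1" "x = (1 - t) * y + t * (r * y)" by (auto simp: in_segment)
    have x: "x = y * ((1 - t) * 1 + t * r)" using t by (simp add: algebra_simps)
    have "(1 - t) * min 1 r + t * min 1 r \<le> (1 - t) * 1 + t * r"
      using t by (intro add_mono mult_left_mono) auto
    then have "min 1 r \<le> (1 - t) * 1 + t * r" by (simp add: algebra_simps)
    then have "\<bar>y\<bar> * min 1 r \<le> \<bar>x\<bar>"
      using r unfolding x abs_mult by (intro mult_left_mono) auto
    then have "(\<bar>y\<bar> * min 1 r) * std_normal_density x \<le> \<bar>x\<bar> * std_normal_density x"
      by (intro mult_right_mono) auto
    also have "\<dots> \<le> 1" using abs_mult_std_normal_density_le_1[of x] by (simp add: abs_mult)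
    finally show "norm (- std_normal_density x) \<le> 1 / (\<bar>y\<bar> * min 1 r)"
      using r False by (simp add: field_simps)
    show "(normal_tail has_real_derivative - std_normal_density x) (at x within closed_segment y (r * y))"
      by (rule has_field_derivative_at_within[OF DERIV_normal_tail])
  qed auto
  also have "norm (r * y - y) = \<bar>r - 1\<bar> * \<bar>y\<bar>" by (simp add: abs_mult[symmetric] algebra_simps)
  also have "1 / (\<bar>y\<bar> * min 1 r) * (\<bar>r - 1\<bar> * \<bar>y\<bar>) = \<bar>r - 1\<bar> / min 1 r"
    using False by (simp add: field_simps)
  also have "\<dots> = \<bar>s - s'\<bar> / min s' s"
  proof -
    have "r - 1 = (s - s') / s'" "min 1 r = min s' s / s'"
      using m by (auto simp: r_def field_simps min_def)
    then show ?thesis using m by simp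
  qed
  also have "\<dots> \<le> \<bar>s - s'\<bar> / m" using m by (intro divide_left_mono) auto
  finally show ?thesis by (simp add: r_def)
qed (use m in simp)

section \<open>Stein's equation\<close>

text \<open>The bounded solution of Stein's equation
  $f'(w) - w f(w) = 1_{w \le z} - \Phi(z)$; its derivative has a jump at $z$, where \<open>stein_sol'\<close>
  is the value prescribed by the equation.\<close>

definition stein_sol :: "real \<Rightarrow> real \<Rightarrow> real" where
  "stein_sol z w = normal_tail (max w z) * (1 - normal_tail (min w z)) / std_normal_density w"

lemma stein_sol_if:
  "stein_sol z w = (if w \<le> z then normal_tail z * (1 - normal_tail w)
                    else (1 - normal_tail z) * normal_tail w) / std_normal_density w"
  by (simp add: stein_sol_def max_def min_def)

definition stein_sol' :: "real \<Rightarrow> real \<Rightarrow> real" where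
  "stein_sol' z w = w * stein_sol z w + of_bool (w \<le> z) - (1 - normal_tail z)"

lemma std_normal_density_neq_0 [simp]: "std_normal_density x \<noteq> 0"
  using normal_density_pos[of 1 0 x] by simp

lemma isCont_stein_sol: "isCont (stein_sol z) w"
  unfolding stein_sol_def[abs_def]
  by (intro continuous_intros continuous_max continuous_min isCont_o2[OF _ isCont_normal_tail]
      DERIV_isCont[OF DERIV_std_normal_density]) auto

lemma DERIV_stein_sol:
  assumes "w \<noteq> z"
  shows "(stein_sol z has_real_derivative stein_sol' z w) (at w)"
proof (cases "w < z")
  case True
  have "((\<lambda>w. normal_tail z * (1 - normal_tail w) / std_normal_density w)
      has_real_derivative stein_sol' z w) (at w)"
    using True by (auto intro!: derivative_eq_intros DERIV_normal_tail DERIV_std_normal_density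
        simp: stein_sol'_def stein_sol_if field_simps)
  then show ?thesis
    by (rule has_field_derivative_transform_within_open[where S="{..<z}"])
      (use True in \<open>auto simp: stein_sol_if\<close>)
next
  case False
  have "((\<lambda>w. (1 - normal_tail z) * normal_tail w / std_normal_density w)
      has_real_derivative stein_sol' z w) (at w)"
    using False assms by (auto intro!: derivative_eq_intros DERIV_normal_tail DERIV_std_normal_density
        simp: stein_sol'_def stein_sol_if field_simps)
  then show ?thesis
    by (rule has_field_derivative_transform_within_open[where S="{z<..}"])
      (use False assms in \<open>auto simp: stein_sol_if\<close>)
qed

lemma abs_mills: "\<bar>w * normal_tail \<bar>w\<bar> / std_normal_density w\<bar> \<le> 1"
proof -
  have e: "std_normal_density \<bar>w\<bar> = std_normal_density w" by (simp add: std_normal_density_def)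
  show ?thesis
    using mills_ratio[of "\<bar>w\<bar>"] normal_density_pos[of 1 0 w] normal_tail_nonneg[of "\<bar>w\<bar>"]
    by (cases "w = 0") (simp_all add: abs_mult e)
qed

text \<open>Everything rests on the signed Mills ratio \<open>m\<close>, with |m| \<le> 1. For w
  \<le> z and w \<le> 0 the value is Q(z) (1 + m) with m in [-1, 0]. For 0 < w \<le> z the numerator
  contains the large tail 1 - Q(w), but Q(z) \<le> Q(w), and Q(w) times the second term is m (1 -
  Q(w)); the total is at most Q(w) + (1 - Q(w)) = 1. The cases z < w mirror these.\<close>

lemma abs_stein_sol'_le: "\<bar>stein_sol' z w\<bar> \<le> 1"
proof -
  define m where "m = w * normal_tail \<bar>w\<bar> / std_normal_density w"
  have m: "\<bar>m\<bar> \<le> 1" unfolding m_def by (rule abs_mills)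
  note b = normal_tail_bounds[of z] normal_tail_bounds[of w]
  have sgn: "w \<ge> 0 \<Longrightarrow> m \<ge> 0" "w \<le> 0 \<Longrightarrow> m \<le> 0"
    unfolding m_def using normal_density_pos[of 1 0 w] normal_tail_nonneg[of "\<bar>w\<bar>"]
    by (auto intro!: divide_nonneg_pos divide_nonpos_pos mult_nonpos_nonneg)
  have aux: "\<bar>a * (1 + c)\<bar> \<le> 1" if "0 \<le> a" "a \<le> 1" "-1 \<le> c" "c \<le> 0" for a c :: real
    using that by (simp add: abs_mult mult_le_one)
  have aux2: "\<bar>a * (1 + c)\<bar> \<le> 1" if "0 \<le> a" "0 \<le> c" "a \<le> b" "b * c \<le> 1 - b" for a b c :: real
  proof -
    have "a * (1 + c) \<le> b * (1 + c)" using that by (intro mult_right_mono) auto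
    then show ?thesis using that by (simp add: abs_mult distrib_left)
  qed
  consider "w \<le> z" "w \<le> 0" | "w \<le> z" "0 < w" | "z < w" "0 \<le> w" | "z < w" "w < 0" by linarith
  then show ?thesis
  proof cases
    case 1
    then have "stein_sol' z w = normal_tail z * (1 + m)"
      by (simp add: stein_sol'_def stein_sol_if m_def normal_tail_uminus algebra_simps)
    then show ?thesis using aux[of "normal_tail z" m] m sgn b 1 by simp
  next
    case 2
    have "stein_sol' z w = normal_tail z * (1 + w * (1 - normal_tail w) / std_normal_density w)"
      using 2 by (simp add: stein_sol'_def stein_sol_if algebra_simps)
    moreover have "normal_tail w * (w * (1 - normal_tail w) / std_normal_density w) = m * (1 - normal_tail w)"
      using 2 by (simp add: m_def)
    moreover have "m * (1 - normal_tail w) \<le> 1 - normal_tail w"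
      using m b by (intro mult_left_le_one_le) (use sgn 2 in auto)
    ultimately show ?thesis
      using aux2[of "normal_tail z" "w * (1 - normal_tail w) / std_normal_density w" "normal_tail w"] b 2
        normal_tail_le_iff[of z w] normal_density_pos[of 1 0 w] by simp
  next
    case 3
    then have "stein_sol' z w = - ((1 - normal_tail z) * (1 + (- m)))"
      by (simp add: stein_sol'_def stein_sol_if m_def algebra_simps)
    then show ?thesis using aux[of "1 - normal_tail z" "- m"] m sgn b 3 by simp
  next
    case 4
    have "stein_sol' z w = - ((1 - normal_tail z) * (1 + (- w) * normal_tail w / std_normal_density w))"
      using 4 by (simp add: stein_sol'_def stein_sol_if algebra_simps)
    moreover have "(1 - normal_tail w) * ((- w) * normal_tail w / std_normal_density w) = (- m) * normal_tail w"
      using 4 by (simp add: m_def normal_tail_uminus)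
    moreover have "(- m) * normal_tail w \<le> normal_tail w"
      using m b by (intro mult_left_le_one_le) (use sgn 4 in auto)
    moreover have "(- w) * normal_tail w / std_normal_density w \<ge> 0"
      using 4 b normal_density_pos[of 1 0 w] by (intro divide_nonneg_pos mult_nonneg_nonneg) auto
    ultimately show ?thesis
      using aux2[of "1 - normal_tail z" "(- w) * normal_tail w / std_normal_density w" "1 - normal_tail w"] b 4
        normal_tail_le_iff[of w z] by simp
  qed
qed

text \<open>Compactness covers [-1, 1]. Outside it the equation itself gives the bound: w f(w) is
  f'(w) minus a quantity of size at most 1, so |f(w)| \<le> |w f(w)| \<le> 2.\<close>

lemma stein_sol_bounded: "\<exists>C. \<forall>w. \<bar>stein_sol z w\<bar> \<le> C"
proof -
  have "compact (stein_sol z ` {-1..1})"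
    by (intro compact_continuous_image continuous_at_imp_continuous_on ballI isCont_stein_sol) auto
  then obtain C where C: "\<And>w. w \<in> {-1..1} \<Longrightarrow> \<bar>stein_sol z w\<bar> \<le> C"
    using compact_imp_bounded bounded_iff by (metis image_eqI real_norm_def)
  have "\<bar>stein_sol z w\<bar> \<le> max C 2" for w
  proof (cases "\<bar>w\<bar> \<le> 1")
    case True
    then have "w \<in> {-1..1}" by auto
    then show ?thesis using C[of w] by (simp add: le_max_iff_disj)
  next
    case False
    have "\<bar>w * stein_sol z w\<bar> \<le> 2"
      using abs_stein_sol'_le[of z w] normal_tail_bounds[of z]
      unfolding stein_sol'_def by (auto split: if_splits simp: of_bool_def)
    moreover have "1 * \<bar>stein_sol z w\<bar> \<le> \<bar>w\<bar> * \<bar>stein_sol z w\<bar>"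
      using False by (intro mult_right_mono) auto
    ultimately show ?thesis by (simp add: abs_mult)
  qed
  then show ?thesis by blast
qed

lemma stein_sol_measurable [measurable]: "stein_sol z \<in> borel_measurable borel"
  by (intro borel_measurable_continuous_onI continuous_at_imp_continuous_on ballI isCont_stein_sol)

lemma stein_sol'_measurable [measurable]: "stein_sol' z \<in> borel_measurable borel"
  unfolding stein_sol'_def of_bool_def by measurable

section \<open>Moments of quadratic functions of a normal vector\<close>

text \<open>Fubini with coordinate i integrated first. It serves both to kill cross moments and to
  lift a one-dimensional Stein identity to the product space.\<close>

lemma (in product_prob_space) integral_PiM_coordinate_eq_0:
  fixes f :: "_ \<Rightarrow> real"
  assumes "finite I" "i \<in> I" "integrable (PiM I M) f" "\<And>x. (\<integral>y. f (x(i := y)) \<partial>M i) = 0"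
  shows "(\<integral>x. f x \<partial>PiM I M) = 0"
proof -
  have I: "insert i (I - {i}) = I" using assms(2) by auto
  show ?thesis
    using product_integral_insert[of "I - {i}" i f] assms unfolding I by simp
qed

text \<open>Distinct centred coordinates are orthogonal, so squaring the sum leaves only the
  diagonal. The products are integrable because 2|ab| \<le> a^2 + b^2.\<close>

lemma (in product_prob_space)
  fixes g :: "'i \<Rightarrow> 'a \<Rightarrow> real"
  assumes "finite I"
    and meas [measurable]: "\<And>i. i \<in> I \<Longrightarrow> g i \<in> borel_measurable (M i)"
    and sq: "\<And>i. i \<in> I \<Longrightarrow> integrable (M i) (\<lambda>y. (g i y)\<^sup>2)"
    and cent: "\<And>i. i \<in> I \<Longrightarrow> (\<integral>y. g i y \<partial>M i) = 0"
  shows integral_PiM_sum_centered: "(\<integral>x. (\<Sum>i\<in>I. g i (x i)) \<partial>PiM I M) = 0"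
    and integrable_PiM_sum_centered: "integrable (PiM I M) (\<lambda>x. \<Sum>i\<in>I. g i (x i))"
    and integrable_PiM_sum_centered_sq: "integrable (PiM I M) (\<lambda>x. (\<Sum>i\<in>I. g i (x i))\<^sup>2)"
    and integral_PiM_sum_centered_sq:
      "(\<integral>x. (\<Sum>i\<in>I. g i (x i))\<^sup>2 \<partial>PiM I M) = (\<Sum>i\<in>I. \<integral>y. (g i y)\<^sup>2 \<partial>M i)"
proof -
  interpret P: prob_space "PiM I M" by (intro prob_space_PiM M.prob_space_axioms)
  have comp: "distr (PiM I M) (M i) (\<lambda>x. x i) = M i" if "i \<in> I" for i
    using that by (intro distr_PiM_component M.prob_space_axioms)
  have gsq: "integrable (PiM I M) (\<lambda>x. (g i (x i))\<^sup>2)" if "i \<in> I" for i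
    using sq[OF that] that
    by (subst (asm) comp[OF that, symmetric], subst (asm) integrable_distr_eq) simp_all
  have gsqi: "(\<integral>x. (g i (x i))\<^sup>2 \<partial>PiM I M) = (\<integral>y. (g i y)\<^sup>2 \<partial>M i)" if "i \<in> I" for i
  proof -
    have "(\<integral>x. (g i (x i))\<^sup>2 \<partial>PiM I M) = (\<integral>y. (g i y)\<^sup>2 \<partial>distr (PiM I M) (M i) (\<lambda>x. x i))"
      using that by (intro integral_distr[symmetric]) simp_all
    then show ?thesis unfolding comp[OF that] .
  qed
  have gg: "integrable (PiM I M) (\<lambda>x. g i (x i) * g j (x j))" if "i \<in> I" "j \<in> I" for i j
  proof (rule Bochner_Integration.integrable_bound)
    show "integrable (PiM I M) (\<lambda>x. (g i (x i))\<^sup>2 + (g j (x j))\<^sup>2)"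
      using that gsq by simp
    show "AE x in PiM I M. norm (g i (x i) * g j (x j)) \<le> norm ((g i (x i))\<^sup>2 + (g j (x j))\<^sup>2)"
    proof (rule AE_I2)
      fix x
      have "0 \<le> (\<bar>g i (x i)\<bar> - \<bar>g j (x j)\<bar>)\<^sup>2" by simp
      then have "2 * \<bar>g i (x i) * g j (x j)\<bar> \<le> (g i (x i))\<^sup>2 + (g j (x j))\<^sup>2"
        by (simp add: power2_diff abs_mult)
      then show "norm (g i (x i) * g j (x j)) \<le> norm ((g i (x i))\<^sup>2 + (g j (x j))\<^sup>2)" by simp
    qed
  qed (use that in measurable)
  have gi: "integrable (PiM I M) (\<lambda>x. g i (x i))" if "i \<in> I" for i
    by (rule P.square_integrable_imp_integrable) (use gsq[OF that] that in simp_all)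
  have ggi: "(\<integral>x. g i (x i) * g j (x j) \<partial>PiM I M) = (if i = j then \<integral>y. (g i y)\<^sup>2 \<partial>M i else 0)"
    if "i \<in> I" "j \<in> I" for i j
  proof (cases "i = j")
    case True
    then show ?thesis using gsqi[of i] that by (simp add: power2_eq_square)
  next
    case False
    have "(\<integral>x. g i (x i) * g j (x j) \<partial>PiM I M) = 0"
      by (rule integral_PiM_coordinate_eq_0[OF assms(1) that(1) gg[OF that]])
        (use False cent that in simp)
    then show ?thesis using False by simp
  qed
  have e: "(\<Sum>i\<in>I. g i (x i))\<^sup>2 = (\<Sum>i\<in>I. \<Sum>j\<in>I. g i (x i) * g j (x j))" for x
    by (simp add: power2_eq_square sum_product)
  show "integrable (PiM I M) (\<lambda>x. \<Sum>i\<in>I. g i (x i))" using gi by simp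
  have "(\<integral>x. g i (x i) \<partial>PiM I M) = 0" if "i \<in> I" for i
    by (rule integral_PiM_coordinate_eq_0[OF assms(1) that gi[OF that]]) (use cent that in simp)
  then show "(\<integral>x. (\<Sum>i\<in>I. g i (x i)) \<partial>PiM I M) = 0"
    using gi by (simp add: Bochner_Integration.integral_sum)
  show "integrable (PiM I M) (\<lambda>x. (\<Sum>i\<in>I. g i (x i))\<^sup>2)"
    unfolding e using gg by (intro Bochner_Integration.integrable_sum) auto
  show "(\<integral>x. (\<Sum>i\<in>I. g i (x i))\<^sup>2 \<partial>PiM I M) = (\<Sum>i\<in>I. \<integral>y. (g i y)\<^sup>2 \<partial>M i)"
    unfolding e using gg assms(1)
    by (simp add: Bochner_Integration.integral_sum ggi cong: sum.cong)
qed

lemma normal_central_moments: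
  assumes "\<sigma> > 0"
  shows "has_bochner_integral (N1 m \<sigma>) (\<lambda>y. y - m) 0"
    "has_bochner_integral (N1 m \<sigma>) (\<lambda>y. (y - m)^2) (\<sigma>\<^sup>2)"
    "has_bochner_integral (N1 m \<sigma>) (\<lambda>y. (y - m)^3) 0"
    "has_bochner_integral (N1 m \<sigma>) (\<lambda>y. (y - m)^4) (3 * \<sigma>^4)"
proof -
  have d: "has_bochner_integral (N1 m \<sigma>) (\<lambda>y. (y - m)^n) c"
    if "has_bochner_integral lborel (\<lambda>x. normal_density m \<sigma> x * (x - m)^n) c" for n c
    using that by (intro has_bochner_integral_density) auto
  show "has_bochner_integral (N1 m \<sigma>) (\<lambda>y. y - m) 0"
    using d[of 1] normal_moment_odd[OF assms, of m 0] by simp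
  show "has_bochner_integral (N1 m \<sigma>) (\<lambda>y. (y - m)^2) (\<sigma>\<^sup>2)"
    using d[OF normal_moment_even[OF assms, of m 1, simplified mult_1_right]] by simp
  show "has_bochner_integral (N1 m \<sigma>) (\<lambda>y. (y - m)^3) 0"
    using d[of 3] normal_moment_odd[OF assms, of m 1] by simp
  have "fact (2 * 2) / ((2 / \<sigma>\<^sup>2)^2 * fact 2) = 3 * \<sigma>^4"
    using assms by (simp add: fact_numeral field_simps)
  then show "has_bochner_integral (N1 m \<sigma>) (\<lambda>y. (y - m)^4) (3 * \<sigma>^4)"
    using d[of 4] normal_moment_even[OF assms, of m 2] by simp
qed

text \<open>The two parts of \<open>q\<close> are multiples of the Hermite polynomials of degree 2
  and 1, hence orthogonal, with variances 2 \<sigma>^4 and \<sigma>^2 before scaling.\<close>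

lemma normal_quadratic_moments:
  fixes \<alpha> \<beta> \<sigma> m :: real
  assumes "\<sigma> > 0"
  defines "q \<equiv> \<lambda>y. \<alpha> * ((y - m)\<^sup>2 - \<sigma>\<^sup>2) + \<beta> * (y - m)"
  shows "(\<integral>y. q y \<partial>N1 m \<sigma>) = 0" "integrable (N1 m \<sigma>) (\<lambda>y. (q y)\<^sup>2)"
    "(\<integral>y. (q y)\<^sup>2 \<partial>N1 m \<sigma>) = 2 * \<alpha>\<^sup>2 * \<sigma>^4 + \<beta>\<^sup>2 * \<sigma>\<^sup>2"
proof -
  interpret prob_space "N1 m \<sigma>" using assms(1) by (rule prob_space_normal_density)
  note mom = normal_central_moments[OF assms(1), of m]
  have c: "has_bochner_integral (N1 m \<sigma>) (\<lambda>_. c) c" for c :: real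
    using prob_space by (simp add: has_bochner_integral_iff)
  have "has_bochner_integral (N1 m \<sigma>) q (\<alpha> * (\<sigma>\<^sup>2 - \<sigma>\<^sup>2) + \<beta> * 0)"
    unfolding q_def
    by (intro has_bochner_integral_add has_bochner_integral_diff has_bochner_integral_mult_right mom c)
  then show "(\<integral>y. q y \<partial>N1 m \<sigma>) = 0" by (simp add: has_bochner_integral_iff)
  have e: "(q y)\<^sup>2 = \<alpha>\<^sup>2 * (y - m)^4 + 2 * \<alpha> * \<beta> * (y - m)^3 + (\<beta>\<^sup>2 - 2 * \<alpha>\<^sup>2 * \<sigma>\<^sup>2) * (y - m)\<^sup>2
      - 2 * \<alpha> * \<beta> * \<sigma>\<^sup>2 * (y - m) + \<alpha>\<^sup>2 * \<sigma>^4" for y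
    unfolding q_def by (simp add: power2_eq_square power3_eq_cube power4_eq_xxxx algebra_simps)
  have "has_bochner_integral (N1 m \<sigma>) (\<lambda>y. (q y)\<^sup>2)
      (\<alpha>\<^sup>2 * (3 * \<sigma>^4) + 2 * \<alpha> * \<beta> * 0 + (\<beta>\<^sup>2 - 2 * \<alpha>\<^sup>2 * \<sigma>\<^sup>2) * \<sigma>\<^sup>2 - 2 * \<alpha> * \<beta> * \<sigma>\<^sup>2 * 0 + \<alpha>\<^sup>2 * \<sigma>^4)"
    unfolding e
    by (intro has_bochner_integral_add has_bochner_integral_diff has_bochner_integral_mult_right mom c)
  moreover have "\<alpha>\<^sup>2 * (3 * \<sigma>^4) + 2 * \<alpha> * \<beta> * 0 + (\<beta>\<^sup>2 - 2 * \<alpha>\<^sup>2 * \<sigma>\<^sup>2) * \<sigma>\<^sup>2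
      - 2 * \<alpha> * \<beta> * \<sigma>\<^sup>2 * 0 + \<alpha>\<^sup>2 * \<sigma>^4 = 2 * \<alpha>\<^sup>2 * \<sigma>^4 + \<beta>\<^sup>2 * \<sigma>\<^sup>2"
    by (simp add: power2_eq_square power4_eq_xxxx algebra_simps)
  ultimately show "integrable (N1 m \<sigma>) (\<lambda>y. (q y)\<^sup>2)"
    "(\<integral>y. (q y)\<^sup>2 \<partial>N1 m \<sigma>) = 2 * \<alpha>\<^sup>2 * \<sigma>^4 + \<beta>\<^sup>2 * \<sigma>\<^sup>2"
    unfolding has_bochner_integral_iff by simp_all
qed

context
  fixes \<sigma> \<alpha> \<beta> :: real and a :: "nat \<Rightarrow> real" and k :: nat and q :: "(nat \<Rightarrow> real) \<Rightarrow> real"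
  assumes \<sigma>: "\<sigma> > 0"
    and q_def: "\<And>x. q x = (\<Sum>i<k. \<alpha> * ((x i - a i)\<^sup>2 - \<sigma>\<^sup>2) + \<beta> * a i * (x i - a i))"
begin

interpretation product_prob_space "\<lambda>i. N1 (a i) \<sigma>" "{..<k}" using \<sigma> by (rule product_prob_N1)

text \<open>One shape covers all the quadratic functions that occur: the centred Stein kernel
  (\<alpha> = 2, \<beta> = 6), the centred shift (\<alpha> = 0, \<beta> = 2 \<rho>) and the centred
  noncentrality (\<alpha> = \<rho>^2, \<beta> = 2 \<rho>^2). In each the linear part is along the
  mean vector, so the variance depends on that vector only through its norm.\<close>

lemma normal_vec_quadratic_moments:
  "integrable (normal_vec k a \<sigma>) q" "(\<integral>x. q x \<partial>normal_vec k a \<sigma>) = 0"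
  "integrable (normal_vec k a \<sigma>) (\<lambda>x. (q x)\<^sup>2)"
  "(\<integral>x. (q x)\<^sup>2 \<partial>normal_vec k a \<sigma>) = 2 * real k * \<alpha>\<^sup>2 * \<sigma>^4 + \<beta>\<^sup>2 * \<sigma>\<^sup>2 * (\<Sum>i<k. (a i)\<^sup>2)"
proof -
  define g where "g = (\<lambda>i y. \<alpha> * ((y - a i)\<^sup>2 - \<sigma>\<^sup>2) + \<beta> * a i * (y - a i))"
  have q: "q = (\<lambda>x. \<Sum>i<k. g i (x i))" by (simp add: q_def[abs_def] g_def)
  have meas: "g i \<in> borel_measurable borel" for i unfolding g_def by measurable
  note m = normal_quadratic_moments[OF \<sigma>, where m="a i" and \<beta>="\<beta> * a i" and \<alpha>=\<alpha> for i]
  have sq: "integrable (N1 (a i) \<sigma>) (\<lambda>y. (g i y)\<^sup>2)" and cent: "(\<integral>y. g i y \<partial>N1 (a i) \<sigma>) = 0"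
    and sqi: "(\<integral>y. (g i y)\<^sup>2 \<partial>N1 (a i) \<sigma>) = 2 * \<alpha>\<^sup>2 * \<sigma>^4 + (\<beta> * a i)\<^sup>2 * \<sigma>\<^sup>2" for i
    using m[of i] by (simp_all add: g_def)
  note facts = integrable_PiM_sum_centered[of g] integral_PiM_sum_centered[of g]
    integrable_PiM_sum_centered_sq[of g] integral_PiM_sum_centered_sq[of g]
  note [simp] = meas sq cent
  show "integrable (normal_vec k a \<sigma>) q"
    unfolding q normal_vec_def by (rule facts) simp_all
  show "(\<integral>x. q x \<partial>normal_vec k a \<sigma>) = 0"
    unfolding q normal_vec_def by (rule facts) simp_all
  show "integrable (normal_vec k a \<sigma>) (\<lambda>x. (q x)\<^sup>2)"
    unfolding q normal_vec_def by (rule facts) simp_all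
  have "(\<integral>x. (q x)\<^sup>2 \<partial>normal_vec k a \<sigma>) = (\<Sum>i<k. \<integral>y. (g i y)\<^sup>2 \<partial>N1 (a i) \<sigma>)"
    unfolding q normal_vec_def by (rule facts) simp_all
  also have "\<dots> = (\<Sum>i<k. 2 * \<alpha>\<^sup>2 * \<sigma>^4 + \<beta>\<^sup>2 * \<sigma>\<^sup>2 * (a i)\<^sup>2)"
    by (intro sum.cong refl) (simp add: sqi power_mult_distrib)
  also have "\<dots> = 2 * real k * \<alpha>\<^sup>2 * \<sigma>^4 + \<beta>\<^sup>2 * \<sigma>\<^sup>2 * (\<Sum>i<k. (a i)\<^sup>2)"
    by (simp add: sum.distrib sum_distrib_left)
  finally show "(\<integral>x. (q x)\<^sup>2 \<partial>normal_vec k a \<sigma>) = 2 * real k * \<alpha>\<^sup>2 * \<sigma>^4 + \<beta>\<^sup>2 * \<sigma>\<^sup>2 * (\<Sum>i<k. (a i)\<^sup>2)" .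
qed

end

section \<open>Normal approximation of the noncentral chi-square tail\<close>

lemma integrable_normal_quadratic_bound:
  fixes g :: "real \<Rightarrow> real"
  assumes [measurable]: "g \<in> borel_measurable borel" and "\<sigma> > 0" and "\<And>x. \<bar>g x\<bar> \<le> K * (1 + x\<^sup>2)"
  shows "integrable (N1 m \<sigma>) g"
proof (rule Bochner_Integration.integrable_bound)
  interpret prob_space "N1 m \<sigma>" using assms(2) by (rule prob_space_normal_density)
  have "integrable (N1 m \<sigma>) (\<lambda>x. K * (1 + ((x - m)\<^sup>2 + 2 * m * (x - m) + m\<^sup>2)))"
    using normal_central_moments[OF assms(2), of m]
    by (intro integrable_mult_right Bochner_Integration.integrable_add integrable_const)
       (auto simp: has_bochner_integral_iff)
  then show "integrable (N1 m \<sigma>) (\<lambda>x. K * (1 + x\<^sup>2))"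
    by (simp add: power2_eq_square algebra_simps)
  show "AE x in N1 m \<sigma>. norm (g x) \<le> norm (K * (1 + x\<^sup>2))"
    using assms(3) by (intro AE_I2) (auto intro: order_trans[OF _ abs_ge_self])
qed simp

text \<open>Times the normal density, the integrand is minus the derivative of
  $(x + a)\,\varphi(x - a)\,f(W x)$ with $f$ the Stein solution.\<close>

lemma stein_quadratic_1d:
  fixes a c s z :: real
  assumes "s > 0"
  defines "W \<equiv> \<lambda>x. (x\<^sup>2 + c) / s"
  defines "G \<equiv> \<lambda>x. (x\<^sup>2 - a\<^sup>2 - 1) * stein_sol z (W x) - 2 * x * (x + a) / s * stein_sol' z (W x)"
  shows "(\<integral>x. G x \<partial>N1 a 1) = 0"
proof -
  let ?d = "normal_density a 1"
  \<comment> \<open>The factor x + a is chosen because the derivative of (x + a) times the density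
    is -(x^2 - a^2 - 1) times the density: it is the antiderivative of the centred square.\<close>
  define h where "h = (\<lambda>x. (x + a) * ?d x * stein_sol z (W x))"
  obtain C where C: "\<And>w. \<bar>stein_sol z w\<bar> \<le> C" using stein_sol_bounded by blast
  then have C0: "C \<ge> 0" using order_trans[OF abs_ge_zero] by blast
  have [measurable]: "W \<in> borel_measurable borel" unfolding W_def by measurable
  have Gm [measurable]: "G \<in> borel_measurable borel" unfolding G_def by measurable
  have intG: "integrable (N1 a 1) G"
  proof (rule integrable_normal_quadratic_bound[where K="(1 + a\<^sup>2) * C + 2 * (2 + a\<^sup>2) / s"])
    fix x
    have b1: "\<bar>x\<^sup>2 - a\<^sup>2 - 1\<bar> \<le> (1 + a\<^sup>2) * (1 + x\<^sup>2)"
      by (simp add: abs_le_iff algebra_simps)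
    have "0 \<le> x\<^sup>2 + a * x + a\<^sup>2 / 4" "0 \<le> x\<^sup>2 - a * x + a\<^sup>2 / 4"
      using zero_le_power2[of "x + a / 2"] zero_le_power2[of "x - a / 2"]
      by (simp_all add: power2_sum power2_diff power_divide mult_ac)
    moreover have "x * (x + a) = x\<^sup>2 + a * x" by (simp add: power2_eq_square algebra_simps)
    ultimately have "\<bar>x * (x + a)\<bar> \<le> 2 * x\<^sup>2 + a\<^sup>2"
      using zero_le_power2[of x] zero_le_power2[of a] unfolding abs_le_iff by linarith
    also have "\<dots> \<le> (2 + a\<^sup>2) * (1 + x\<^sup>2)" by (simp add: algebra_simps)
    finally have "2 / s * \<bar>x * (x + a)\<bar> \<le> 2 / s * ((2 + a\<^sup>2) * (1 + x\<^sup>2))"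
      using assms(1) by (intro mult_left_mono) auto
    moreover have "\<bar>2 * x * (x + a) / s\<bar> = 2 / s * \<bar>x * (x + a)\<bar>"
      using assms(1) by (simp only: abs_mult abs_divide) simp
    moreover have "2 / s * ((2 + a\<^sup>2) * (1 + x\<^sup>2)) = 2 * (2 + a\<^sup>2) / s * (1 + x\<^sup>2)" by simp
    ultimately have b2: "\<bar>2 * x * (x + a) / s\<bar> \<le> 2 * (2 + a\<^sup>2) / s * (1 + x\<^sup>2)"
      by (simp only:)
    have "\<bar>G x\<bar> \<le> \<bar>x\<^sup>2 - a\<^sup>2 - 1\<bar> * \<bar>stein_sol z (W x)\<bar> + \<bar>2 * x * (x + a) / s\<bar> * \<bar>stein_sol' z (W x)\<bar>"
      unfolding G_def by (simp only: abs_mult[symmetric] abs_triangle_ineq4)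
    also have "\<dots> \<le> ((1 + a\<^sup>2) * (1 + x\<^sup>2)) * C + (2 * (2 + a\<^sup>2) / s * (1 + x\<^sup>2)) * 1"
      using C C0 assms(1) by (intro add_mono mult_mono b1 b2 abs_stein_sol'_le) auto
    finally show "\<bar>G x\<bar> \<le> ((1 + a\<^sup>2) * C + 2 * (2 + a\<^sup>2) / s) * (1 + x\<^sup>2)"
      by (simp add: algebra_simps)
  qed simp_all
  define h' where "h' = (\<lambda>x. - (?d x * G x))"
  have inth': "integrable lborel h'"
    using intG unfolding h'_def by (subst (asm) integrable_density) auto
  \<comment> \<open>These at most two points are where the Stein solution has its kink; the
    fundamental theorem of calculus tolerates finitely many exceptions for a continuous
    function.\<close>
  have fin: "finite {x. W x = z}"
  proof (rule finite_subset)
    show "{x. W x = z} \<subseteq> {sqrt (s * z - c), - sqrt (s * z - c)}"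
    proof
      fix x assume "x \<in> {x. W x = z}"
      then have "s * z - c = x\<^sup>2" using assms(1) by (auto simp: W_def field_simps)
      then show "x \<in> {sqrt (s * z - c), - sqrt (s * z - c)}" by (auto simp: abs_if)
    qed
  qed simp
  have Dd: "(?d has_real_derivative - (x - a) * ?d x) (at x)" for x
  proof -
    have "?d = (\<lambda>x. std_normal_density (x - a))" by (simp add: normal_density_def fun_eq_iff)
    moreover have "((\<lambda>x. x - a) has_real_derivative 1) (at x)"
      by (auto intro!: derivative_eq_intros)
    from DERIV_chain2[OF DERIV_std_normal_density this]
    have "((\<lambda>x. std_normal_density (x - a)) has_real_derivative - (x - a) * std_normal_density (x - a)) (at x)"
      by simp
    ultimately show ?thesis by simp
  qed
  have DW: "(W has_real_derivative 2 * x / s) (at x)" for x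
    unfolding W_def using assms(1) by (auto intro!: derivative_eq_intros)
  have Dh: "(h has_real_derivative h' x) (at x)" if "W x \<noteq> z" for x
  proof -
    have "((\<lambda>x. stein_sol z (W x)) has_real_derivative stein_sol' z (W x) * (2 * x / s)) (at x)"
      using DERIV_chain2[OF DERIV_stein_sol[OF that] DW] .
    then have "(h has_real_derivative ((?d x + (x + a) * (- (x - a) * ?d x)) * stein_sol z (W x)
        + (x + a) * ?d x * (stein_sol' z (W x) * (2 * x / s)))) (at x)"
      unfolding h_def using assms(1) by (auto intro!: derivative_eq_intros Dd simp: field_simps)
    moreover have "(?d x + (x + a) * (- (x - a) * ?d x)) * stein_sol z (W x)
        + (x + a) * ?d x * (stein_sol' z (W x) * (2 * x / s)) = h' x"
      using assms(1) by (simp add: h'_def G_def field_simps power2_eq_square)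
    ultimately show ?thesis by simp
  qed
  have cont: "isCont h x" for x
    unfolding h_def
    by (intro continuous_intros DERIV_isCont[OF Dd] isCont_o2[OF DERIV_isCont[OF DW] isCont_stein_sol])
  have ftc: "(\<integral>x. indicator {- real n..real n} x *\<^sub>R h' x \<partial>lborel) = h (real n) - h (- real n)" for n :: nat
  proof -
    have "(h' has_integral (h (real n) - h (- real n))) {- real n..real n}"
      by (rule fundamental_theorem_of_calculus_interior_strong[OF fin])
        (use Dh in \<open>auto simp: has_real_derivative_iff_has_vector_derivative
            intro!: continuous_at_imp_continuous_on cont\<close>)
    moreover have "set_integrable lborel {- real n..real n} h'"
      unfolding set_integrable_def using inth' by (intro integrable_mult_indicator) auto
    ultimately show ?thesis
      using set_borel_integral_eq_integral(2)[of "{- real n..real n}" h']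
      by (simp add: set_lebesgue_integral_def integral_unique)
  qed
  have lim1: "(\<lambda>n::nat. \<integral>x. indicator {- real n..real n} x *\<^sub>R h' x \<partial>lborel) \<longlonglongrightarrow> (\<integral>x. h' x \<partial>lborel)"
  proof (rule integral_dominated_convergence[where w="\<lambda>x. \<bar>h' x\<bar>"])
    show "AE x in lborel. (\<lambda>n::nat. indicator {- real n..real n} x *\<^sub>R h' x) \<longlonglongrightarrow> h' x"
    proof (rule AE_I2)
      fix x
      have "eventually (\<lambda>n::nat. \<bar>x\<bar> \<le> real n) sequentially"
        by (rule eventually_sequentiallyI[of "nat \<lceil>\<bar>x\<bar>\<rceil>"]) linarith
      then have "eventually (\<lambda>n::nat. h' x = indicator {- real n..real n} x *\<^sub>R h' x) sequentially"
        by eventually_elim (auto simp: indicator_def)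
      then show "(\<lambda>n::nat. indicator {- real n..real n} x *\<^sub>R h' x) \<longlonglongrightarrow> h' x"
        by (rule Lim_transform_eventually[OF tendsto_const])
    qed
  qed (use inth' in \<open>auto simp: indicator_def\<close>)
  have hb: "norm (h x) \<le> C * \<bar>(x + a) * ?d x\<bar>" for x
    using mult_left_mono[OF C[of "W x"], of "\<bar>(x + a) * ?d x\<bar>"] by (simp add: h_def abs_mult mult_ac)
  have h0: "(h \<longlongrightarrow> 0) F" if "((\<lambda>x. (x + a) * ?d x) \<longlongrightarrow> 0) F" for F
  proof (rule Lim_null_comparison)
    show "((\<lambda>x. C * \<bar>(x + a) * ?d x\<bar>) \<longlongrightarrow> 0) F"
      using tendsto_mult[OF tendsto_const tendsto_rabs[OF that], of C] by simp
  qed (intro always_eventually allI hb)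
  have "((\<lambda>x. (x + a) * ?d x) \<longlongrightarrow> 0) at_top" "((\<lambda>x. (x + a) * ?d x) \<longlongrightarrow> 0) at_bot"
    unfolding normal_density_def by real_asymp+
  then have "(h \<longlongrightarrow> 0) at_top" "(h \<longlongrightarrow> 0) at_bot" using h0 by blast+
  moreover have "filterlim (\<lambda>n. - real n) at_bot sequentially"
    by (rule filterlim_compose[OF filterlim_uminus_at_bot_at_top filterlim_real_sequentially])
  ultimately have "(\<lambda>n. h (real n) - h (- real n)) \<longlonglongrightarrow> 0 - 0"
    using filterlim_compose[OF _ filterlim_real_sequentially] filterlim_compose by (intro tendsto_diff) blast+
  then have "(\<integral>x. h' x \<partial>lborel) = 0"
    using LIMSEQ_unique[OF lim1[unfolded ftc]] by simp
  then show ?thesis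
    unfolding h'_def by (simp add: integral_density)
qed

lemma integrable_normal_vec_component:
  assumes "\<sigma> > 0" "i < k" "integrable (N1 (v i) \<sigma>) g"
  shows "integrable (normal_vec k v \<sigma>) (\<lambda>x. g (x i) :: real)"
proof -
  have c: "distr (normal_vec k v \<sigma>) (N1 (v i) \<sigma>) (\<lambda>x. x i) = N1 (v i) \<sigma>"
    unfolding normal_vec_def
    by (rule distr_PiM_component) (use assms in \<open>auto intro: prob_space_normal_density\<close>)
  have "integrable (distr (normal_vec k v \<sigma>) (N1 (v i) \<sigma>) (\<lambda>x. x i)) g"
    unfolding c by (rule assms(3))
  then show ?thesis
    by (rule integrable_distr[rotated]) (use assms(2) in \<open>simp add: normal_vec_def\<close>)
qed

lemma noncentral_chi2_stein:
  fixes k :: nat and v :: "nat \<Rightarrow> real" and z l s :: real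
  assumes k: "1 \<le> k"
  defines "l \<equiv> \<Sum>i<k. (v i)\<^sup>2"
  defines "s \<equiv> sqrt (2 * real k + 4 * l)"
  defines "M \<equiv> normal_vec k v 1"
  defines "W \<equiv> \<lambda>x. ((\<Sum>i<k. (x i)\<^sup>2) - real k - l) / s"
  defines "\<Gamma> \<equiv> \<lambda>x::nat \<Rightarrow> real. \<Sum>i<k. 2 * x i * (x i + v i)"
  shows "integrable M (\<lambda>x. W x * stein_sol z (W x) - \<Gamma> x / s\<^sup>2 * stein_sol' z (W x))" (is ?int)
    and "(\<integral>x. W x * stein_sol z (W x) - \<Gamma> x / s\<^sup>2 * stein_sol' z (W x) \<partial>M) = 0" (is ?eq)
proof -
  interpret P: product_prob_space "\<lambda>i. N1 (v i) 1" "{..<k}" by (rule product_prob_N1) simp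
  have l: "l \<ge> 0" unfolding l_def by (rule sum_nonneg) simp
  have s: "s > 0" unfolding s_def using k l by (intro real_sqrt_gt_zero) linarith
  obtain C where C: "\<And>w. \<bar>stein_sol z w\<bar> \<le> C" using stein_sol_bounded by blast
  have [measurable]: "W \<in> borel_measurable M" unfolding W_def M_def by measurable
  have xm [measurable]: "i < k \<Longrightarrow> (\<lambda>x. x i) \<in> borel_measurable M" for i
    unfolding M_def by measurable
  define T where "T = (\<lambda>i x. ((x i)\<^sup>2 - (v i)\<^sup>2 - 1) * stein_sol z (W x)
     - 2 * x i * (x i + v i) / s * stein_sol' z (W x))"
  have T1: "integrable M (T i)" if i: "i < k" for i
  proof -
    have 1: "integrable M (\<lambda>x. (x i)\<^sup>2 - (v i)\<^sup>2 - 1)" unfolding M_def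
      by (rule integrable_normal_vec_component[where g="\<lambda>y. y\<^sup>2 - (v i)\<^sup>2 - 1", OF _ i])
        (auto intro!: integrable_normal_quadratic_bound[where K="1 + (v i)\<^sup>2"]
          simp: abs_le_iff algebra_simps)
    have 2: "integrable M (\<lambda>x. 2 * x i * (x i + v i) / s)" unfolding M_def
    proof (rule integrable_normal_vec_component[where g="\<lambda>y. 2 * y * (y + v i) / s", OF _ i])
      interpret prob_space "N1 (v i) 1" by (rule prob_space_normal_density) simp
      have "integrable (N1 (v i) 1) (\<lambda>y. (2 * (y - v i)\<^sup>2 + 6 * v i * (y - v i) + 4 * (v i)\<^sup>2) / s)"
        using normal_central_moments[of 1 "v i"] by (auto simp: has_bochner_integral_iff)
      moreover have "(2 * (y - v i)\<^sup>2 + 6 * v i * (y - v i) + 4 * (v i)\<^sup>2) / s = 2 * y * (y + v i) / s" for y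
        by (simp add: power2_eq_square algebra_simps)
      ultimately show "integrable (N1 (v i) 1) (\<lambda>y. 2 * y * (y + v i) / s)" by simp
    qed simp
    have "integrable M (\<lambda>x. ((x i)\<^sup>2 - (v i)\<^sup>2 - 1) * stein_sol z (W x))"
    proof (rule Bochner_Integration.integrable_bound)
      show "integrable M (\<lambda>x. C * ((x i)\<^sup>2 - (v i)\<^sup>2 - 1))" using 1 by simp
      show "AE x in M. norm (((x i)\<^sup>2 - (v i)\<^sup>2 - 1) * stein_sol z (W x)) \<le> norm (C * ((x i)\<^sup>2 - (v i)\<^sup>2 - 1))"
        by (rule AE_I2) (simp add: abs_mult mult.commute[of C], intro mult_left_mono order_trans[OF C abs_ge_self], simp)
    qed (use i in measurable)
    moreover have "integrable M (\<lambda>x. 2 * x i * (x i + v i) / s * stein_sol' z (W x))"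
    proof (rule Bochner_Integration.integrable_bound[OF 2])
      show "AE x in M. norm (2 * x i * (x i + v i) / s * stein_sol' z (W x)) \<le> norm (2 * x i * (x i + v i) / s)"
        unfolding norm_mult[of _ "stein_sol' z _"] using abs_stein_sol'_le
        by (intro AE_I2 mult_right_le_one_le) auto
    qed (use i in measurable)
    ultimately show ?thesis unfolding T_def by (rule Bochner_Integration.integrable_diff)
  qed
  have T0: "(\<integral>x. T i x \<partial>M) = 0" if i: "i < k" for i
    unfolding M_def normal_vec_def
  proof (rule P.integral_PiM_coordinate_eq_0)
    show "integrable (PiM {..<k} (\<lambda>i. N1 (v i) 1)) (T i)" using T1[OF i] by (simp add: M_def normal_vec_def)
    fix x :: "nat \<Rightarrow> real"
    \<comment> \<open>With the other coordinates frozen, W becomes (y^2 + c) / s, the form required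
      by the one-dimensional identity.\<close>
    define c where "c = (\<Sum>j\<in>{..<k} - {i}. (x j)\<^sup>2) - k - l"
    have "W (x(i := y)) = (y\<^sup>2 + c) / s" for y
    proof -
      have "(\<Sum>j<k. ((x(i := y)) j)\<^sup>2) = y\<^sup>2 + (\<Sum>j\<in>{..<k} - {i}. ((x(i := y)) j)\<^sup>2)"
        using i by (subst sum.remove[of _ i]) auto
      also have "(\<Sum>j\<in>{..<k} - {i}. ((x(i := y)) j)\<^sup>2) = (\<Sum>j\<in>{..<k} - {i}. (x j)\<^sup>2)"
        by (intro sum.cong) auto
      finally show ?thesis by (simp add: W_def c_def)
    qed
    then show "(\<integral>y. T i (x(i := y)) \<partial>N1 (v i) 1) = 0"
      using stein_quadratic_1d[OF s, of "v i" z c] by (simp add: T_def)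
  qed (use i in auto)
  have sum: "W x * stein_sol z (W x) - \<Gamma> x / s\<^sup>2 * stein_sol' z (W x) = (\<Sum>i<k. T i x) / s" for x
  proof -
    have "(\<Sum>i<k. T i x) = (\<Sum>i<k. (x i)\<^sup>2 - (v i)\<^sup>2 - 1) * stein_sol z (W x) - \<Gamma> x / s * stein_sol' z (W x)"
    proof -
      have "(\<Sum>i<k. A i * f - B i / s * g) = (\<Sum>i<k. A i) * f - (\<Sum>i<k. B i) / s * g"
        for A B and f g :: real
        by (simp add: sum_subtractf sum_distrib_right sum_divide_distrib)
      then show ?thesis unfolding T_def \<Gamma>_def .
    qed
    also have "(\<Sum>i<k. (x i)\<^sup>2 - (v i)\<^sup>2 - 1) = s * W x"
      using s by (simp add: W_def l_def sum_subtractf)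
    finally show ?thesis using s by (simp add: power2_eq_square diff_divide_distrib)
  qed
  have "integrable M (\<lambda>x. \<Sum>i<k. T i x)"
    by (intro Bochner_Integration.integrable_sum T1) simp
  moreover have "(\<integral>x. (\<Sum>i<k. T i x) \<partial>M) = 0"
    using T0 T1 by (subst Bochner_Integration.integral_sum) simp_all
  ultimately show ?int ?eq unfolding sum by simp_all
qed

text \<open>Stein's equation and the kernel identity turn the error in the distribution function of
  W into the mean of (1 - \<Gamma>/s^2) f'(W). As |f'| \<le> 1, it is at most the mean of |q| / s^2,
  where q is the centred kernel. Its variance 8 k + 36 l is at most 9 s^2, which is the origin of
  the 3.\<close>

lemma chi2_tail_normal_approx:
  fixes k :: nat and l t s :: real
  assumes k: "1 \<le> k" and l: "0 \<le> l"
  defines "s \<equiv> sqrt (2 * real k + 4 * l)"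
  shows "\<bar>chi2_tail k l t - normal_tail ((t - k - l) / s)\<bar> \<le> 3 / s"
proof -
  define v where "v = axis_vec (sqrt l)"
  define M where "M = normal_vec k v 1"
  define W where "W = (\<lambda>x. ((\<Sum>i<k. (x i)\<^sup>2) - real k - l) / s)"
  define \<Gamma> where "\<Gamma> = (\<lambda>x::nat \<Rightarrow> real. \<Sum>i<k. 2 * x i * (x i + v i))"
  define z where "z = (t - k - l) / s"
  define q where "q = (\<lambda>x. \<Sum>i<k. 2 * ((x i - v i)\<^sup>2 - 1\<^sup>2) + 6 * v i * (x i - v i))"
  interpret prob_space M unfolding M_def by (rule prob_space_normal_vec) simp
  have vl: "(\<Sum>i<k. (v i)\<^sup>2) = l"
    using k l by (simp add: v_def axis_vec_def if_distrib[of "\<lambda>x. x\<^sup>2"] cong: if_cong)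
  have s: "s > 0" and s2: "s\<^sup>2 = 2 * real k + 4 * l" unfolding s_def using k l by auto
  have [measurable]: "W \<in> borel_measurable M" "\<Gamma> \<in> borel_measurable M"
    unfolding W_def \<Gamma>_def M_def by measurable
  have st: "integrable M (\<lambda>x. W x * stein_sol z (W x) - \<Gamma> x / s\<^sup>2 * stein_sol' z (W x))"
    "(\<integral>x. W x * stein_sol z (W x) - \<Gamma> x / s\<^sup>2 * stein_sol' z (W x) \<partial>M) = 0"
    using noncentral_chi2_stein[OF k, where v=v and z=z] by (simp_all only: W_def \<Gamma>_def M_def s_def vl)
  have q: "integrable M q" "(\<integral>x. (q x)\<^sup>2 \<partial>M) = 8 * k + 36 * l" "integrable M (\<lambda>x. (q x)\<^sup>2)"
    using normal_vec_quadratic_moments[OF _ fun_cong[OF q_def], folded M_def] by (simp_all add: vl)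
  have \<Gamma>: "\<Gamma> x = s\<^sup>2 + q x" for x
  proof -
    \<comment> \<open>With x = v + u one has 2 x (x + v) = 2 + 4 v^2 + 2 (u^2 - 1) + 6 v u.\<close>
    have "\<Gamma> x = (\<Sum>i<k. 2 + 4 * (v i)\<^sup>2) + q x"
      unfolding \<Gamma>_def q_def sum.distrib[symmetric]
      by (intro sum.cong refl) (simp add: power2_eq_square algebra_simps)
    then show ?thesis unfolding s2 by (simp add: sum.distrib vl flip: sum_distrib_left)
  qed
  have tail: "chi2_tail k l t = 1 - (\<integral>x. of_bool (W x \<le> z) \<partial>M)"
  proof -
    have "chi2_tail k l t = measure M ((\<lambda>x. \<Sum>i<k. (x i)\<^sup>2) -` {t<..} \<inter> space M)"
      unfolding chi2_tail_def noncentral_chi2_def M_def v_def by (rule measure_distr) measurable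
    also have "(\<lambda>x. \<Sum>i<k. (x i)\<^sup>2) -` {t<..} \<inter> space M = space M - {x \<in> space M. W x \<le> z}"
      using s by (auto simp: W_def z_def divide_le_cancel)
    also have "prob \<dots> = 1 - prob {x \<in> space M. W x \<le> z}" by (rule prob_compl) measurable
    also have "prob {x \<in> space M. W x \<le> z} = (\<integral>x. indicator {x \<in> space M. W x \<le> z} x \<partial>M)"
      by (simp add: Int_absorb2 subset_iff)
    also have "\<dots> = (\<integral>x. of_bool (W x \<le> z) \<partial>M)"
      by (intro Bochner_Integration.integral_cong refl) (simp add: indicator_def)
    finally show ?thesis .
  qed
  have bi: "integrable M (\<lambda>x. of_bool (W x \<le> z) :: real)"
    by (rule integrable_const_bound[where B=1]) (auto simp: of_bool_def)
  have "integrable M (\<lambda>x. of_bool (W x \<le> z) - (1 - normal_tail z))"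
    "(\<integral>x. of_bool (W x \<le> z) - (1 - normal_tail z) \<partial>M) = normal_tail z - chi2_tail k l t"
    using bi by (simp_all add: tail prob_space)
  then have "normal_tail z - chi2_tail k l t = (\<integral>x. (of_bool (W x \<le> z) - (1 - normal_tail z))
      + (W x * stein_sol z (W x) - \<Gamma> x / s\<^sup>2 * stein_sol' z (W x)) \<partial>M)"
    using st by (subst Bochner_Integration.integral_add) simp_all
  also have "\<dots> = (\<integral>x. - (q x / s\<^sup>2 * stein_sol' z (W x)) \<partial>M)"
    using s by (intro Bochner_Integration.integral_cong refl) (simp add: \<Gamma> stein_sol'_def field_simps)
  finally have "\<bar>normal_tail z - chi2_tail k l t\<bar> \<le> (\<integral>x. \<bar>q x / s\<^sup>2 * stein_sol' z (W x)\<bar> \<partial>M)"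
    using integral_abs_bound[of M "\<lambda>x. - (q x / s\<^sup>2 * stein_sol' z (W x))"] by simp
  \<comment> \<open>The arithmetic-geometric mean inequality with weight 3 s, the bound on the
    standard deviation of q, takes the place of Cauchy-Schwarz.\<close>
  also have "\<dots> \<le> (\<integral>x. (3 * s + (q x)\<^sup>2 / (3 * s)) / (2 * s\<^sup>2) \<partial>M)"
  proof (rule integral_mono_AE')
    show "integrable M (\<lambda>x. (3 * s + (q x)\<^sup>2 / (3 * s)) / (2 * s\<^sup>2))" using q by simp
    show "AE x in M. \<bar>q x / s\<^sup>2 * stein_sol' z (W x)\<bar> \<le> (3 * s + (q x)\<^sup>2 / (3 * s)) / (2 * s\<^sup>2)"
    proof (rule AE_I2)
      fix x
      have "\<bar>q x / s\<^sup>2 * stein_sol' z (W x)\<bar> \<le> \<bar>q x / s\<^sup>2\<bar>"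
        unfolding abs_mult[of _ "stein_sol' z _"] using abs_stein_sol'_le by (intro mult_right_le_one_le) auto
      also have "\<dots> = \<bar>q x\<bar> / s\<^sup>2" by simp
      also have "\<bar>q x\<bar> \<le> (3 * s + (q x)\<^sup>2 / (3 * s)) / 2"
      proof -
        have "0 \<le> (\<bar>q x\<bar> - 3 * s)\<^sup>2" by simp
        then show ?thesis using s by (simp add: power2_diff field_simps power2_eq_square[of s])
      qed
      finally show "\<bar>q x / s\<^sup>2 * stein_sol' z (W x)\<bar> \<le> (3 * s + (q x)\<^sup>2 / (3 * s)) / (2 * s\<^sup>2)"
        using s by (simp add: divide_right_mono field_simps)
    qed
  qed (use s in simp)
  also have "\<dots> = (3 * s + (8 * k + 36 * l) / (3 * s)) / (2 * s\<^sup>2)"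
    using q by (simp add: prob_space)
  also have "\<dots> \<le> (3 * s + 9 * s\<^sup>2 / (3 * s)) / (2 * s\<^sup>2)"
    using s l by (intro divide_right_mono add_left_mono) (auto simp: s2)
  also have "\<dots> = 3 / s" using s by (simp add: power2_eq_square field_simps)
  finally show ?thesis by (simp add: z_def abs_minus_commute)
qed

section \<open>The detection probability\<close>

lemma chi2_tail_nonneg: "0 \<le> chi2_tail k l t"
  and chi2_tail_le_1: "chi2_tail k l t \<le> 1"
proof -
  interpret real_distribution "noncentral_chi2 k l" by (rule real_distribution_noncentral_chi2)
  show "0 \<le> chi2_tail k l t" "chi2_tail k l t \<le> 1" by (simp_all add: chi2_tail_def)
qed

text \<open>Here y is the threshold standardized for noncentrality l; standardizing the same
  threshold for l' gives (s y - d) / s'. The conditions in \<open>good\<close> keep s and s' above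
  fixed fractions of D. The third estimate is stated for every x, so that y can later be exchanged
  for an argument that is independent of l.\<close>

lemma chi2_tail_threshold_approx:
  fixes k :: nat and l l' D p s s' d \<tau> :: real
  assumes k: "1 \<le> k" and l: "0 \<le> l" "0 \<le> l'" and p: "0 < p" "p < 1" and D: "0 < D"
  defines "s \<equiv> sqrt (2 * real k + 4 * l)" and "s' \<equiv> sqrt (2 * real k + 4 * l')" and "d \<equiv> l' - l"
  defines "\<tau> \<equiv> chi2_tail_inv k l p"
  assumes good: "\<bar>s - D\<bar> \<le> D / 2" "\<bar>d\<bar> \<le> D\<^sup>2 / 32"
  obtains y where "\<bar>normal_tail y - p\<bar> \<le> 6 / D"
    and "\<bar>chi2_tail k l' \<tau> - normal_tail ((s * y - d) / s')\<bar> \<le> 9 / D"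
    and "\<And>x. \<bar>normal_tail ((s * x - d) / s') - normal_tail (x - d / D)\<bar>
           \<le> 15 * \<bar>d\<bar> / D\<^sup>2 + 3 * \<bar>d\<bar> * \<bar>s - D\<bar> / D\<^sup>2"
    and "s > 0" "s' > 0"
proof
  have s2: "s\<^sup>2 = 2 * real k + 4 * l" "s'\<^sup>2 = 2 * real k + 4 * l'"
    unfolding s_def s'_def using l by auto
  have sD: "D / 2 \<le> s" using good(1) by linarith
  show s0: "s > 0" "s' > 0" using k l unfolding s_def s'_def by auto
  \<comment> \<open>The 1/32 is used here: s'^2 = s^2 + 4 d is at least D^2/4 - D^2/8, which exceeds
    D^2/9.\<close>
  have s'D: "D / 3 \<le> s'"
  proof (rule power2_le_imp_le)
    have "(D / 2)\<^sup>2 \<le> s\<^sup>2" using sD D by (intro power_mono) auto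
    moreover have "s'\<^sup>2 = s\<^sup>2 + 4 * d" by (simp add: s2 d_def)
    moreover have "- (D\<^sup>2 / 32) \<le> d" using good(2) by linarith
    moreover have "(D / 2)\<^sup>2 = D\<^sup>2 / 4" "(D / 3)\<^sup>2 = D\<^sup>2 / 9" by (simp_all add: power_divide)
    ultimately show "(D / 3)\<^sup>2 \<le> s'\<^sup>2"
      using zero_le_power2[of D] by linarith
  qed (use s0 in simp)
  define y where "y = (\<tau> - k - l) / s"
  have "3 / s \<le> 6 / D" using sD D s0 by (simp add: field_simps)
  then show "\<bar>normal_tail y - p\<bar> \<le> 6 / D"
    using chi2_tail_normal_approx[OF k l(1), of \<tau>, folded s_def, folded y_def]
      chi2_tail_inv(2)[OF k p, of l, folded \<tau>_def] by linarith
  have "3 / s' \<le> 9 / D" using s'D D s0 by (simp add: field_simps)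
  moreover have "(\<tau> - k - l') / s' = (s * y - d) / s'" using s0 by (simp add: y_def d_def)
  ultimately show "\<bar>chi2_tail k l' \<tau> - normal_tail ((s * y - d) / s')\<bar> \<le> 9 / D"
    using chi2_tail_normal_approx[OF k l(2), of \<tau>, folded s'_def] by (metis order_trans)
  fix x
  define r where "r = x - d / D"
  \<comment> \<open>A dilation of x - d/D by s/s', whose cost is uniform in x, plus a translation
    that is small in both d and s - D.\<close>
  have e: "(s * x - d) / s' = s / s' * r + d * (s - D) / (D * s')"
    using s0 D by (simp add: r_def field_simps)
  have "\<bar>s - s'\<bar> * (s + s') = 4 * \<bar>d\<bar>"
  proof -
    have "\<bar>s - s'\<bar> * (s + s') = \<bar>(s - s') * (s + s')\<bar>" using s0 by (simp add: abs_mult)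
    also have "(s - s') * (s + s') = - 4 * d"
      using s2 by (simp add: d_def power2_eq_square algebra_simps)
    finally show ?thesis by (simp add: abs_mult)
  qed
  moreover have "\<bar>s - s'\<bar> * (5 / 6 * D) \<le> \<bar>s - s'\<bar> * (s + s')"
    using sD s'D by (intro mult_left_mono) auto
  ultimately have "\<bar>s - s'\<bar> * D \<le> 5 * \<bar>d\<bar>" by simp
  then have ss: "\<bar>s - s'\<bar> / (D / 3) \<le> 15 * \<bar>d\<bar> / D\<^sup>2"
    using D by (simp add: field_simps power2_eq_square)
  have "\<bar>d * (s - D) / (D * s')\<bar> = \<bar>d\<bar> * \<bar>s - D\<bar> / (D * s')"
    using D s0 by (simp add: abs_mult)
  also have "\<dots> \<le> \<bar>d\<bar> * \<bar>s - D\<bar> / (D * (D / 3))"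
    using s'D D by (intro divide_left_mono mult_left_mono) auto
  finally have "\<bar>d * (s - D) / (D * s')\<bar> \<le> 3 * \<bar>d\<bar> * \<bar>s - D\<bar> / D\<^sup>2"
    by (simp add: power2_eq_square mult_ac)
  moreover have "\<bar>normal_tail ((s * x - d) / s') - normal_tail (s / s' * r)\<bar> \<le> \<bar>d * (s - D) / (D * s')\<bar>"
    using normal_tail_lipschitz[of "(s * x - d) / s'" "s / s' * r"] by (simp add: e)
  moreover have "\<bar>normal_tail (s / s' * r) - normal_tail r\<bar> \<le> \<bar>s - s'\<bar> / (D / 3)"
    using sD s'D D by (intro normal_tail_scale) auto
  ultimately show "\<bar>normal_tail ((s * x - d) / s') - normal_tail (x - d / D)\<bar>
      \<le> 15 * \<bar>d\<bar> / D\<^sup>2 + 3 * \<bar>d\<bar> * \<bar>s - D\<bar> / D\<^sup>2"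
    using ss unfolding r_def by linarith
qed

text \<open>The argument y of the threshold varies with l, but Q(y) stays within 6/D of p, so a
  fixed x with Q(x) outside this window lies on a known side of y, and monotonicity of Q transfers
  the order to the shifted arguments. The error R is quadratic in d and in s^2 - D^2, so that its
  mean involves only second moments.\<close>

lemma chi2_tail_threshold_bounds:
  fixes k :: nat and l l' D p b d R x :: real
  assumes k: "1 \<le> k" and l: "0 \<le> l" "0 \<le> l'" and p: "0 < p" "p < 1" and D: "0 < D" and b: "1 / D \<le> b"
  defines "d \<equiv> l' - l"
  defines "R \<equiv> 26 * b + 18 * b * (d / D)\<^sup>2 + 3 / (D^4 * b) * (2 * real k + 4 * l - D\<^sup>2)\<^sup>2"
  shows "p + 6 / D \<le> normal_tail x \<Longrightarrow>
      chi2_tail k l' (chi2_tail_inv k l p) \<le> normal_tail (x - d / D) + R" (is "?A \<Longrightarrow> ?B")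
    and "normal_tail x \<le> p - 6 / D \<Longrightarrow>
      normal_tail (x - d / D) - R \<le> chi2_tail k l' (chi2_tail_inv k l p)" (is "?A' \<Longrightarrow> ?B'")
proof -
  define s where "s = sqrt (2 * real k + 4 * l)"
  define s' where "s' = sqrt (2 * real k + 4 * l')"
  define u where "u = \<bar>d\<bar> / D"
  define w where "w = \<bar>s - D\<bar> / D"
  define v where "v = \<bar>2 * real k + 4 * l - D\<^sup>2\<bar> / D\<^sup>2"
  define \<beta> where "\<beta> = chi2_tail k l' (chi2_tail_inv k l p)"
  \<comment> \<open>The coefficients 2 and 32 are the reciprocals of the cutoffs 1/2 and 1/32 for |s
    - D| / D and |d| / D^2, so that E is at least 1 as soon as either cutoff is exceeded.\<close>
  define E where "E = 9 / D + 32 * \<bar>d\<bar> / D\<^sup>2 + 2 * w + 3 * \<bar>d\<bar> * \<bar>s - D\<bar> / D\<^sup>2"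
  have b0: "b > 0" using b D by (intro less_le_trans[of 0 "1 / D" b]) auto
  have u0: "u \<ge> 0" "w \<ge> 0" "v \<ge> 0" using D by (auto simp: u_def w_def v_def)
  have \<beta>: "0 \<le> \<beta>" "\<beta> \<le> 1" by (simp_all add: \<beta>_def chi2_tail_nonneg chi2_tail_le_1)
  \<comment> \<open>Passing from s to s^2 removes the square root: s^2 is affine in l, so its
    moments are available.\<close>
  have wv: "w \<le> v"
  proof -
    have "s \<ge> 0" and s2: "s\<^sup>2 = 2 * real k + 4 * l" unfolding s_def using l by auto
    have "\<bar>s - D\<bar> * D \<le> \<bar>s - D\<bar> * (s + D)" using \<open>s \<ge> 0\<close> by (intro mult_left_mono) auto
    moreover have "\<bar>s - D\<bar> * (s + D) = \<bar>s\<^sup>2 - D\<^sup>2\<bar>"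
    proof -
      have "\<bar>s - D\<bar> * (s + D) = \<bar>(s - D) * (s + D)\<bar>" using \<open>s \<ge> 0\<close> D by (simp add: abs_mult)
      also have "(s - D) * (s + D) = s\<^sup>2 - D\<^sup>2" by (simp add: power2_eq_square algebra_simps)
      finally show ?thesis .
    qed
    ultimately have "\<bar>s - D\<bar> * D / D\<^sup>2 \<le> v"
      unfolding v_def s2 by (intro divide_right_mono) auto
    then show ?thesis using D by (simp add: w_def power2_eq_square)
  qed
  have ER: "E \<le> R"
  proof -
    have "E = 9 * (1 / D) + 32 * u * (1 / D) + 2 * w + 3 * u * w"
      using D by (simp add: E_def u_def w_def field_simps power2_eq_square)
    also have "\<dots> \<le> 9 * b + 32 * u * b + 2 * v + 3 * u * v"
      using b D u0 wv by (intro add_mono mult_mono) auto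
    also have "\<dots> \<le> 26 * b + 18 * b * u\<^sup>2 + 3 / b * v\<^sup>2"
    proof -
      \<comment> \<open>Arithmetic-geometric mean inequalities balanced by b. The b terms add up to
        9 + 16 + 1 = 26, the X terms to 16 + 3/2, rounded up to 18, and the Y terms to 1 + 3/2,
        rounded up to 3.\<close>
      define X Y T U where "X = b * u\<^sup>2" and "Y = v\<^sup>2 / b" and "T = u * b" and "U = u * v"
      have "32 * T \<le> 16 * b + 16 * X"
        using mult_left_mono[OF zero_le_power2[of "u - 1"], of "16 * b"] b0
        by (simp add: X_def T_def power2_diff algebra_simps)
      moreover have "2 * v \<le> b + Y"
        using zero_le_power2[of "v - b"] b0 by (simp add: Y_def power2_diff field_simps power2_eq_square)
      moreover have "3 * U \<le> 3 / 2 * (X + Y)"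
        using zero_le_power2[of "b * u - v"] b0
        by (simp add: X_def Y_def U_def power2_diff field_simps power2_eq_square)
      moreover have "0 \<le> X" "0 \<le> Y" using b0 by (auto simp: X_def Y_def)
      ultimately have "9 * b + 32 * T + 2 * v + 3 * U \<le> 26 * b + 18 * X + 3 * Y" by argo
      then show ?thesis by (simp add: X_def Y_def T_def U_def mult_ac)
    qed
    also have "\<dots> = R" using D b0
      by (simp add: R_def u_def v_def field_simps flip: power_mult)
    finally show ?thesis .
  qed
  have main: "(?A \<longrightarrow> \<beta> \<le> normal_tail (x - d / D) + E) \<and> (?A' \<longrightarrow> normal_tail (x - d / D) - E \<le> \<beta>)"
  proof (cases "\<bar>s - D\<bar> \<le> D / 2 \<and> \<bar>d\<bar> \<le> D\<^sup>2 / 32")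
    case True
    then obtain y where y: "\<bar>normal_tail y - p\<bar> \<le> 6 / D"
      "\<bar>\<beta> - normal_tail ((s * y - d) / s')\<bar> \<le> 9 / D"
      and ap: "\<And>x. \<bar>normal_tail ((s * x - d) / s') - normal_tail (x - d / D)\<bar>
           \<le> 15 * \<bar>d\<bar> / D\<^sup>2 + 3 * \<bar>d\<bar> * \<bar>s - D\<bar> / D\<^sup>2"
      and s0: "s > 0" "s' > 0"
      using chi2_tail_threshold_approx[OF k l p D, folded s_def s'_def d_def \<beta>_def] by metis
    have E: "9 / D + (15 * \<bar>d\<bar> / D\<^sup>2 + 3 * \<bar>d\<bar> * \<bar>s - D\<bar> / D\<^sup>2) \<le> E"
    proof -
      have "15 * \<bar>d\<bar> / D\<^sup>2 \<le> 32 * \<bar>d\<bar> / D\<^sup>2" by (intro divide_right_mono) auto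
      then show ?thesis using u0(2) by (simp add: E_def)
    qed
    have mono: "normal_tail ((s * y1 - d) / s') \<le> normal_tail ((s * y2 - d) / s')"
      if "normal_tail y1 \<le> normal_tail y2" for y1 y2
      using that s0 by (simp add: normal_tail_le_iff divide_right_mono)
    show ?thesis
    proof (intro conjI impI)
      assume ?A
      then have "normal_tail y \<le> normal_tail x" using y(1) by linarith
      from mono[OF this] show "\<beta> \<le> normal_tail (x - d / D) + E"
        using y(2) ap[of x] E by linarith
    next
      assume ?A'
      then have "normal_tail x \<le> normal_tail y" using y(1) by linarith
      from mono[OF this] show "normal_tail (x - d / D) - E \<le> \<beta>"
        using y(2) ap[of x] E by linarith
    qed
  next
    case False
    \<comment> \<open>the error term exceeds 1 here, so the bounds are trivial\<close>
    then have "1 \<le> 2 * w + 32 * \<bar>d\<bar> / D\<^sup>2"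
    proof (cases "\<bar>s - D\<bar> \<le> D / 2")
      case True
      then have "1 \<le> 32 * \<bar>d\<bar> / D\<^sup>2" using False D by (simp add: field_simps)
      then show ?thesis using u0 by linarith
    next
      case False
      then have "1 \<le> 2 * w" using D by (simp add: w_def field_simps)
      moreover have "0 \<le> 32 * \<bar>d\<bar> / D\<^sup>2" by simp
      ultimately show ?thesis by linarith
    qed
    moreover have "0 \<le> 9 / D" "0 \<le> 3 * \<bar>d\<bar> * \<bar>s - D\<bar> / D\<^sup>2" using D by simp_all
    ultimately have "1 \<le> E" unfolding E_def by linarith
    then show ?thesis
      using \<beta> normal_tail_nonneg[of "x - d / D"] normal_tail_le_1[of "x - d / D"] by linarith
  qed
  show "?A \<Longrightarrow> ?B" "?A' \<Longrightarrow> ?B'" using main ER unfolding \<beta>_def by linarith+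
qed

text \<open>Here \<open>L\<close> plays the role of the smaller index of noncentrality,
  \<open>m\<close> is the mean of the shift and \<open>e\<close> its centred part. Expanding Q about
  x - m/D makes the fluctuation enter through its variance \<open>e2\<close> rather than through its
  standard deviation.\<close>

lemma (in prob_space) expected_chi2_tail_bounds:
  fixes k :: nat and D p b m x e2 v2 :: real and L e :: "'a \<Rightarrow> real"
  assumes k: "1 \<le> k" and p: "0 < p" "p < 1" and D: "0 < D" and b: "1 / D \<le> b"
    and L [measurable]: "L \<in> borel_measurable M" and L0: "\<And>\<omega>. 0 \<le> L \<omega>" "\<And>\<omega>. 0 \<le> L \<omega> + m + e \<omega>"
    and e: "has_bochner_integral M e 0" "has_bochner_integral M (\<lambda>\<omega>. (e \<omega>)\<^sup>2) e2"
    and V: "has_bochner_integral M (\<lambda>\<omega>. (2 * real k + 4 * L \<omega> - D\<^sup>2)\<^sup>2) v2"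
  defines "B \<equiv> expectation (\<lambda>\<omega>. chi2_tail k (L \<omega> + m + e \<omega>) (chi2_tail_inv k (L \<omega>) p))"
  defines "R \<equiv> 26 * b + 18 * b * (m / D)\<^sup>2 + (1 / D\<^sup>2 + 18 * b / D\<^sup>2) * e2 + 3 / (D^4 * b) * v2"
  shows "p + 6 / D \<le> normal_tail x \<Longrightarrow> B \<le> normal_tail (x - m / D) + R"
    and "normal_tail x \<le> p - 6 / D \<Longrightarrow> normal_tail (x - m / D) - R \<le> B"
proof -
  have [measurable]: "e \<in> borel_measurable M" using e(1) by (auto simp: has_bochner_integral_iff)
  note [measurable] = borel_measurable_chi2_tail[OF k] borel_measurable_chi2_tail_inv[OF k p]
  let ?\<beta> = "\<lambda>\<omega>. chi2_tail k (L \<omega> + m + e \<omega>) (chi2_tail_inv k (L \<omega>) p)"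
  define V where "V = (\<lambda>\<omega>. 2 * real k + 4 * L \<omega> - D\<^sup>2)"
  define a where "a = x - m / D"
  have \<beta>: "\<bar>?\<beta> \<omega>\<bar> \<le> 1" for \<omega>
    using chi2_tail_nonneg chi2_tail_le_1 by (simp add: abs_le_iff order_trans[of _ 0])
  have int: "integrable M ?\<beta>"
    by (rule integrable_const_bound[where B=1]) (auto simp: \<beta>)
  have c: "has_bochner_integral M (\<lambda>_. c) c" for c :: real
    using prob_space by (simp add: has_bochner_integral_iff)
  have exp: "(L \<omega> + m + e \<omega> - L \<omega>) / D = m / D + e \<omega> / D" for \<omega>
    by (simp add: add_divide_distrib)
  have tl: "\<bar>normal_tail (x - (m / D + e \<omega> / D)) - (normal_tail a + std_normal_density a / D * e \<omega>)\<bar> \<le> 1 / D\<^sup>2 * (e \<omega>)\<^sup>2" for \<omega>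
    using normal_tail_taylor[of a "- e \<omega> / D"] by (simp add: a_def power_divide diff_diff_eq)
  have sq: "18 * b * (m / D + e \<omega> / D)\<^sup>2
      = 18 * b * (m / D)\<^sup>2 + 36 * b * m / D\<^sup>2 * e \<omega> + 18 * b / D\<^sup>2 * (e \<omega>)\<^sup>2" for \<omega>
    using D by (simp add: power2_eq_square field_simps)
  have sq': "(1 / D\<^sup>2 + 18 * b / D\<^sup>2) * (e \<omega>)\<^sup>2 = 1 / D\<^sup>2 * (e \<omega>)\<^sup>2 + 18 * b / D\<^sup>2 * (e \<omega>)\<^sup>2" for \<omega>
    by (rule distrib_right)
  {
    assume A: "p + 6 / D \<le> normal_tail x"
    \<comment> \<open>A pointwise majorant, quadratic in \<open>e\<close> and \<open>V\<close>, in
      which Q is already replaced by its Taylor polynomial. Its mean is explicit, and the linear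
      terms in \<open>e\<close>, from Q and from the square of d/D, both drop out.\<close>
    let ?g = "\<lambda>\<omega>. (normal_tail a + 26 * b + 18 * b * (m / D)\<^sup>2) + (std_normal_density a / D + 36 * b * m / D\<^sup>2) * e \<omega>
      + (1 / D\<^sup>2 + 18 * b / D\<^sup>2) * (e \<omega>)\<^sup>2 + 3 / (D^4 * b) * (V \<omega>)\<^sup>2"
    have h: "has_bochner_integral M ?g ((normal_tail a + 26 * b + 18 * b * (m / D)\<^sup>2)
      + (std_normal_density a / D + 36 * b * m / D\<^sup>2) * 0 + (1 / D\<^sup>2 + 18 * b / D\<^sup>2) * e2 + 3 / (D^4 * b) * v2)"
      unfolding V_def by (intro has_bochner_integral_add has_bochner_integral_mult_right c e assms)
    have "?\<beta> \<omega> \<le> ?g \<omega>" for \<omega>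
    proof -
      have "(std_normal_density a / D + 36 * b * m / D\<^sup>2) * e \<omega>
        = std_normal_density a / D * e \<omega> + 36 * b * m / D\<^sup>2 * e \<omega>" by (rule distrib_right)
      then show ?thesis using chi2_tail_threshold_bounds(1)[OF k L0(1)[of \<omega>] L0(2)[of \<omega>] p D b A]
         tl[of \<omega>] sq[of \<omega>] sq'[of \<omega>] unfolding exp V_def by linarith
    qed
    then have "B \<le> (\<integral>\<omega>. ?g \<omega> \<partial>M)" unfolding B_def
      using h int by (intro integral_mono) (auto simp: has_bochner_integral_iff)
    then show "B \<le> normal_tail (x - m / D) + R"
      using h by (simp add: has_bochner_integral_iff R_def a_def)
  }
  {
    assume A: "normal_tail x \<le> p - 6 / D"
    let ?g = "\<lambda>\<omega>. (normal_tail a - 26 * b - 18 * b * (m / D)\<^sup>2) + (std_normal_density a / D - 36 * b * m / D\<^sup>2) * e \<omega>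
      - (1 / D\<^sup>2 + 18 * b / D\<^sup>2) * (e \<omega>)\<^sup>2 - 3 / (D^4 * b) * (V \<omega>)\<^sup>2"
    have h: "has_bochner_integral M ?g ((normal_tail a - 26 * b - 18 * b * (m / D)\<^sup>2)
      + (std_normal_density a / D - 36 * b * m / D\<^sup>2) * 0 - (1 / D\<^sup>2 + 18 * b / D\<^sup>2) * e2 - 3 / (D^4 * b) * v2)"
      unfolding V_def by (intro has_bochner_integral_add has_bochner_integral_diff has_bochner_integral_mult_right c e assms)
    have "?g \<omega> \<le> ?\<beta> \<omega>" for \<omega>
    proof -
      have "(std_normal_density a / D - 36 * b * m / D\<^sup>2) * e \<omega>
        = std_normal_density a / D * e \<omega> - 36 * b * m / D\<^sup>2 * e \<omega>" by (rule left_diff_distrib)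
      then show ?thesis using chi2_tail_threshold_bounds(2)[OF k L0(1)[of \<omega>] L0(2)[of \<omega>] p D b A]
         tl[of \<omega>] sq[of \<omega>] sq'[of \<omega>] unfolding exp V_def by linarith
    qed
    then have "(\<integral>\<omega>. ?g \<omega> \<partial>M) \<le> B" unfolding B_def
      using h int by (intro integral_mono) (auto simp: has_bochner_integral_iff)
    then show "normal_tail (x - m / D) - R \<le> B"
      using h by (simp add: has_bochner_integral_iff R_def a_def)
  }
qed

section \<open>From one-sided bounds to a point on the curve\<close>

lemma normal_curve_point_near:
  fixes e p P \<eta> \<epsilon> :: real
  assumes p: "0 < p" "p < 1" and P: "0 \<le> P" "P \<le> 1" and \<epsilon>: "0 < \<epsilon>"
    and lo: "\<And>x. normal_tail x \<ge> p + \<epsilon> \<Longrightarrow> P \<le> normal_tail (x - e) + \<epsilon>"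
    and hi: "\<And>x. normal_tail x \<le> p - \<epsilon> \<Longrightarrow> normal_tail (x - e) - \<epsilon> \<le> P"
  obtains x where "\<bar>normal_tail x - p\<bar> \<le> \<epsilon>" "\<bar>normal_tail (x - e) - P\<bar> \<le> \<epsilon>"
proof -
  have lo': "\<exists>x. \<bar>normal_tail x - p\<bar> \<le> \<epsilon> \<and> P \<le> normal_tail (x - e) + \<epsilon>"
  proof (cases "p + \<epsilon> < 1")
    case True
    then obtain x where "normal_tail x = p + \<epsilon>" using normal_tail_surj[of "p + \<epsilon>"] p \<epsilon> by auto
    then show ?thesis using lo[of x] \<epsilon> by (intro exI[of _ x]) auto
  next
    \<comment> \<open>The window reaches past 1. Far to the left both Q(x) and Q(x - e) are close to
      1, and P \<le> 1 gives the inequality.\<close>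
    case False
    have sh: "filterlim (\<lambda>x. x - e) at_bot at_bot" by real_asymp
    have "eventually (\<lambda>x. normal_tail x > p) at_bot"
      using order_tendstoD(1)[OF normal_tail_at_bot] p by simp
    moreover have "((\<lambda>x. normal_tail (x - e)) \<longlongrightarrow> 1) at_bot"
      by (rule filterlim_compose[OF normal_tail_at_bot sh])
    then have "eventually (\<lambda>x. normal_tail (x - e) > 1 - \<epsilon>) at_bot"
      using order_tendstoD(1) \<epsilon> by fastforce
    ultimately obtain x where "normal_tail x > p" "normal_tail (x - e) > 1 - \<epsilon>"
      using eventually_happens[OF eventually_conj] by fastforce
    then show ?thesis using P False normal_tail_le_1[of x] by (intro exI[of _ x]) auto
  qed
  have hi': "\<exists>x. \<bar>normal_tail x - p\<bar> \<le> \<epsilon> \<and> normal_tail (x - e) - \<epsilon> \<le> P"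
  proof (cases "0 < p - \<epsilon>")
    case True
    then obtain x where "normal_tail x = p - \<epsilon>" using normal_tail_surj[of "p - \<epsilon>"] p \<epsilon> by auto
    then show ?thesis using hi[of x] \<epsilon> by (intro exI[of _ x]) auto
  next
    case False
    have sh: "filterlim (\<lambda>x. x - e) at_top at_top" by real_asymp
    have "eventually (\<lambda>x. normal_tail x < p) at_top"
      using order_tendstoD(2)[OF normal_tail_at_top] p by simp
    moreover have "((\<lambda>x. normal_tail (x - e)) \<longlongrightarrow> 0) at_top"
      by (rule filterlim_compose[OF normal_tail_at_top sh])
    then have "eventually (\<lambda>x. normal_tail (x - e) < \<epsilon>) at_top"
      using order_tendstoD(2) \<epsilon> by fastforce
    ultimately obtain x where "normal_tail x < p" "normal_tail (x - e) < \<epsilon>"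
      using eventually_happens[OF eventually_conj] by fastforce
    then show ?thesis using P False normal_tail_nonneg[of x] by (intro exI[of _ x]) auto
  qed
  obtain a where a: "\<bar>normal_tail a - p\<bar> \<le> \<epsilon>" "P \<le> normal_tail (a - e) + \<epsilon>" using lo' by blast
  obtain b where b: "\<bar>normal_tail b - p\<bar> \<le> \<epsilon>" "normal_tail (b - e) - \<epsilon> \<le> P" using hi' by blast
  \<comment> \<open>Either one of the two points already serves, or Q(x - e) - P changes sign
    between them. A zero in between stays in the window around p because Q is monotone.\<close>
  consider "normal_tail (a - e) \<le> P + \<epsilon>" | "P - \<epsilon> \<le> normal_tail (b - e)"
    | "P \<le> normal_tail (a - e)" "normal_tail (b - e) \<le> P" using \<epsilon> by linarith
  then show thesis
  proof cases
    case 1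
    then show ?thesis using that[of a] a by (simp add: abs_le_iff)
  next
    case 2
    then show ?thesis using that[of b] b by (simp add: abs_le_iff)
  next
    case 3
    then have "normal_tail (b - e) \<le> normal_tail (a - e)" by linarith
    then have "a \<le> b" by (simp add: normal_tail_le_iff)
    moreover have "isCont (\<lambda>x. normal_tail (x - e)) y" for y
      by (rule isCont_o2[OF _ isCont_normal_tail]) (intro continuous_intros)
    ultimately obtain x where x: "a \<le> x" "x \<le> b" "normal_tail (x - e) = P"
      using IVT2[of "\<lambda>x. normal_tail (x - e)" b P a] 3 by auto
    then have "normal_tail b \<le> normal_tail x" "normal_tail x \<le> normal_tail a"
      by (simp_all add: normal_tail_le_iff)
    then show ?thesis using that[of x] x \<epsilon> a b by (simp add: abs_le_iff)
  qed
qed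

section \<open>Moments of shift and noncentrality under the law of X\<close>

lemma umm_pMD_bounds:
  fixes p \<Delta> \<rho> x :: real and k :: nat
  assumes k: "1 \<le> k" and p: "0 < p" "p < 1" and \<Delta>: "0 < \<Delta>" and \<rho>: "0 \<le> \<rho>"
  defines "m \<equiv> \<Delta>\<^sup>2 * (1 + 2 * \<rho>)" and "D \<equiv> sqrt (2 * real k * (1 + 2 * \<rho>) + 4 * (1 + \<rho>)\<^sup>2 * \<Delta>\<^sup>2)"
  assumes b: "1 / D \<le> b"
  defines "R \<equiv> 26 * b + 18 * b * (m / D)\<^sup>2 + (1 / D\<^sup>2 + 18 * b / D\<^sup>2) * (4 * \<rho> * \<Delta>\<^sup>2)
    + 3 / (D^4 * b) * (16 * (2 * real k * \<rho>\<^sup>2 + 4 * \<rho>^3 * \<Delta>\<^sup>2 + m\<^sup>2))"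
  shows "p + 6 / D \<le> normal_tail x \<Longrightarrow> 1 - umm_pMD p \<Delta> \<rho> k \<le> normal_tail (x - m / D) + R" (is "?A1 \<Longrightarrow> ?B1")
    and "normal_tail x \<le> p - 6 / D \<Longrightarrow> normal_tail (x - m / D) - R \<le> 1 - umm_pMD p \<Delta> \<rho> k" (is "?A2 \<Longrightarrow> ?B2")
    and "umm_pMD p \<Delta> \<rho> k \<in> {0..1}"
proof -
  define a where "a = axis_vec \<Delta>"
  have a2: "(\<Sum>i<k. (a i)\<^sup>2) = \<Delta>\<^sup>2"
    using k by (simp add: a_def axis_vec_def if_distrib[of "\<lambda>x. x\<^sup>2"] cong: if_cong)
  have D2: "D\<^sup>2 = 2 * real k * (1 + 2 * \<rho>) + 4 * (1 + \<rho>)\<^sup>2 * \<Delta>\<^sup>2"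
    unfolding D_def using \<rho> by (intro real_sqrt_pow2) auto
  have D: "0 < D" unfolding D_def using k \<rho> \<Delta> by (intro real_sqrt_gt_zero add_pos_nonneg) auto
  \<comment> \<open>For \<open>\<rho> = 0\<close> nothing below depends on the sample point, and any positive \<open>\<sigma>\<close> will do.\<close>
  define \<sigma> where "\<sigma> = (if \<rho> = 0 then 1 else sqrt (1 / \<rho>))"
  have \<sigma>: "\<sigma> > 0" using \<rho> by (simp add: \<sigma>_def)
  have \<rho>\<sigma>: "\<rho> * \<sigma>\<^sup>2 = (if \<rho> = 0 then 0 else 1)" "\<rho>\<^sup>2 * \<sigma>\<^sup>2 = \<rho>" "\<rho>^4 * \<sigma>^4 = \<rho>\<^sup>2" "\<rho>^4 * \<sigma>\<^sup>2 = \<rho>^3"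
    using \<rho> by (simp_all add: \<sigma>_def power_divide power2_eq_square power3_eq_cube power4_eq_xxxx)
  let ?M = "normal_vec k a \<sigma>"
  interpret prob_space ?M using \<sigma> by (rule prob_space_normal_vec)
  define L where "L = (\<lambda>x. \<Sum>i<k. (\<rho> * x i)\<^sup>2)"
  define e where "e = (\<lambda>x. \<Sum>i<k. 0 * ((x i - a i)\<^sup>2 - \<sigma>\<^sup>2) + 2 * \<rho> * a i * (x i - a i))"
  define q where "q = (\<lambda>x. \<Sum>i<k. \<rho>\<^sup>2 * ((x i - a i)\<^sup>2 - \<sigma>\<^sup>2) + 2 * \<rho>\<^sup>2 * a i * (x i - a i))"
  have L': "L y + m + e y = (\<Sum>i<k. (\<rho> * y i + a i)\<^sup>2)" for y
  proof -
    have "(\<Sum>i<k. (\<rho> * y i + a i)\<^sup>2) = L y + (1 + 2 * \<rho>) * (\<Sum>i<k. (a i)\<^sup>2) + e y"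
      unfolding L_def e_def sum_distrib_left sum.distrib[symmetric]
      by (intro sum.cong refl) (simp add: power2_eq_square algebra_simps)
    then show ?thesis by (simp add: a2 m_def)
  qed
  \<comment> \<open>D^2 is the mean of s'^2 = s^2 + 4 d, so s^2 has mean D^2 - 4 m. This bias is why
    m^2 appears next to the variance of \<open>q\<close>.\<close>
  have V: "2 * real k + 4 * L y - D\<^sup>2 = 4 * q y - 4 * m" for y
  proof -
    have "L y = q y + (\<Sum>i<k. \<rho>\<^sup>2 * \<sigma>\<^sup>2 + \<rho>\<^sup>2 * (a i)\<^sup>2)"
      unfolding L_def q_def sum.distrib[symmetric]
      by (intro sum.cong refl) (simp add: power2_eq_square algebra_simps)
    also have "\<dots> = q y + real k * \<rho> + \<rho>\<^sup>2 * \<Delta>\<^sup>2"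
      by (simp add: sum.distrib \<rho>\<sigma> a2 flip: sum_distrib_left)
    finally show ?thesis unfolding D2 by (simp add: m_def power2_eq_square algebra_simps)
  qed
  note Me = normal_vec_quadratic_moments[OF \<sigma> fun_cong[OF e_def]]
  note Mq = normal_vec_quadratic_moments[OF \<sigma> fun_cong[OF q_def]]
  have e1: "has_bochner_integral ?M e 0" using Me by (simp add: has_bochner_integral_iff)
  have "(2 * \<rho>)\<^sup>2 * \<sigma>\<^sup>2 = 4 * \<rho>" using \<rho>\<sigma>(2) by (simp add: power_mult_distrib)
  then have e2: "has_bochner_integral ?M (\<lambda>y. (e y)\<^sup>2) (4 * \<rho> * \<Delta>\<^sup>2)"
    using Me by (simp add: has_bochner_integral_iff a2)
  have "2 * real k * (\<rho>\<^sup>2)\<^sup>2 * \<sigma>^4 + (2 * \<rho>\<^sup>2)\<^sup>2 * \<sigma>\<^sup>2 * \<Delta>\<^sup>2 = 2 * real k * (\<rho>^4 * \<sigma>^4) + 4 * (\<rho>^4 * \<sigma>\<^sup>2) * \<Delta>\<^sup>2"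
    by (simp add: power_mult_distrib flip: power_mult)
  then have q2: "has_bochner_integral ?M (\<lambda>y. (q y)\<^sup>2) (2 * real k * \<rho>\<^sup>2 + 4 * \<rho>^3 * \<Delta>\<^sup>2)"
    using Mq by (simp add: has_bochner_integral_iff a2 \<rho>\<sigma>)
  have q1: "has_bochner_integral ?M q 0" using Mq by (simp add: has_bochner_integral_iff)
  have c: "has_bochner_integral ?M (\<lambda>_. c) c" for c :: real
    using prob_space by (simp add: has_bochner_integral_iff)
  have v2: "has_bochner_integral ?M (\<lambda>y. (2 * real k + 4 * L y - D\<^sup>2)\<^sup>2)
      (16 * (2 * real k * \<rho>\<^sup>2 + 4 * \<rho>^3 * \<Delta>\<^sup>2 + m\<^sup>2))"
  proof -
    have "has_bochner_integral ?M (\<lambda>y. 16 * (q y)\<^sup>2 - 32 * m * q y + 16 * m\<^sup>2)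
      (16 * (2 * real k * \<rho>\<^sup>2 + 4 * \<rho>^3 * \<Delta>\<^sup>2) - 32 * m * 0 + 16 * m\<^sup>2)"
      by (intro has_bochner_integral_add has_bochner_integral_diff has_bochner_integral_mult_right c q1 q2)
    also have "(\<lambda>y. 16 * (q y)\<^sup>2 - 32 * m * q y + 16 * m\<^sup>2) = (\<lambda>y. (2 * real k + 4 * L y - D\<^sup>2)\<^sup>2)"
      unfolding V by (simp add: power2_eq_square algebra_simps)
    finally show ?thesis by (simp only: distrib_left mult_zero_right diff_zero)
  qed
  have Lm: "L \<in> borel_measurable ?M" unfolding L_def by measurable
  have L0: "0 \<le> L y" "0 \<le> L y + m + e y" for y
    unfolding L' by (simp_all add: L_def sum_nonneg)
  let ?B = "expectation (\<lambda>y. chi2_tail k (L y + m + e y) (chi2_tail_inv k (L y) p))"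
  have umm: "1 - umm_pMD p \<Delta> \<rho> k = ?B"
  proof (cases "\<rho> = 0")
    case True
    then have "L = (\<lambda>_. 0)" "e = (\<lambda>_. 0)" "m = \<Delta>\<^sup>2" by (auto simp: L_def e_def m_def)
    then show ?thesis using True by (simp add: umm_pMD_def prob_space)
  next
    case False
    then show ?thesis
      unfolding L' by (simp add: umm_pMD_def umm_pMD_at_def a_def L_def \<sigma>_def)
  qed
  note main = expected_chi2_tail_bounds[OF k p D b Lm L0 e1 e2 v2, folded umm R_def]
  show "?A1 \<Longrightarrow> ?B1" "?A2 \<Longrightarrow> ?B2" using main by blast+
  have "0 \<le> ?B" by (rule Bochner_Integration.integral_nonneg) (rule chi2_tail_nonneg)
  moreover have "?B \<le> (\<integral>y. 1 \<partial>?M)"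
    by (rule integral_mono') (simp_all add: chi2_tail_le_1)
  then have "?B \<le> 1" by (simp add: prob_space)
  ultimately show "umm_pMD p \<Delta> \<rho> k \<in> {0..1}" unfolding umm[symmetric] by simp
qed

section \<open>Size of the error terms\<close>

lemma umm_pMD_near_curve:
  fixes p \<Delta> \<rho> c C :: real and k :: nat
  assumes k: "1 \<le> k" and p: "0 < p" "p < 1" and \<Delta>: "0 < \<Delta>" and \<rho>: "0 \<le> \<rho>"
    and c: "0 < c" "c \<le> eff_snr \<Delta> \<rho> k" and C: "eff_snr \<Delta> \<rho> k \<le> C"
  defines "\<epsilon> \<equiv> 100 * (1 + C\<^sup>2) * sqrt (1 + 1 / c\<^sup>2) / sqrt (max (real k) \<rho>)"
  obtains x where "\<bar>normal_tail x - p\<bar> \<le> \<epsilon>"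
    and "\<bar>normal_tail (x - eff_snr \<Delta> \<rho> k) - (1 - umm_pMD p \<Delta> \<rho> k)\<bar> \<le> \<epsilon>"
proof -
  define m where "m = \<Delta>\<^sup>2 * (1 + 2 * \<rho>)"
  define D where "D = sqrt (2 * real k * (1 + 2 * \<rho>) + 4 * (1 + \<rho>)\<^sup>2 * \<Delta>\<^sup>2)"
  \<comment> \<open>The variance of s^2 is at most 16 (1 + \<rho>) D^2, so b is the order of the
    fluctuation of s^2 relative to D^2; it also dominates 1/D.\<close>
  define b where "b = sqrt (1 + \<rho>) / D"
  define E where "E = eff_snr \<Delta> \<rho> k"
  define M where "M = max (real k) \<rho>"
  have M: "M \<ge> 1" using k by (simp add: M_def)
  have D2: "D\<^sup>2 = 2 * real k * (1 + 2 * \<rho>) + 4 * (1 + \<rho>)\<^sup>2 * \<Delta>\<^sup>2"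
    unfolding D_def using \<rho> by (intro real_sqrt_pow2) auto
  have D: "0 < D" unfolding D_def using k \<rho> \<Delta> by (intro real_sqrt_gt_zero add_pos_nonneg) auto
  have E: "E = m / D" by (simp add: E_def eff_snr_def m_def D_def)
  have E0: "c \<le> E" "E \<le> C" "0 < E" using c C by (auto simp: E_def)
  then have E2: "E\<^sup>2 \<le> C\<^sup>2" by (intro power_mono) auto
  have bD: "1 / D \<le> b" unfolding b_def using D \<rho> by (intro divide_right_mono) auto
  have b2: "b\<^sup>2 = (1 + \<rho>) / D\<^sup>2" using \<rho> by (simp add: b_def power_divide)
  have b0: "b > 0" using D \<rho> by (simp add: b_def)
  \<comment> \<open>Two lower bounds on D^2 are played against each other: k (1 + \<rho>), immediate
    from the definition, is used for \<rho> \<le> k, and c^2 (1 + \<rho>)^2 for \<rho> > k. The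
    second one is where the lower bound on \<open>eff_snr\<close> enters, through 2 (1 + \<rho>) E
    \<le> D.\<close>
  have "(1 + \<rho>) / D\<^sup>2 \<le> (1 + 1 / c\<^sup>2) / M"
  proof -
    have "2 * (1 + \<rho>) * E \<le> D"
    proof -
      have "m * (2 * (1 + \<rho>)) \<le> 4 * (1 + \<rho>)\<^sup>2 * \<Delta>\<^sup>2"
      proof -
        have "(1 + 2 * \<rho>) * (2 * (1 + \<rho>)) \<le> 4 * (1 + \<rho>)\<^sup>2"
          using \<rho> by (simp add: power2_eq_square algebra_simps)
        from mult_left_mono[OF this, of "\<Delta>\<^sup>2"] show ?thesis by (simp add: m_def mult_ac)
      qed
      also have "\<dots> \<le> D * D" using k \<rho> by (simp add: D2 flip: power2_eq_square)
      finally show ?thesis using D by (simp add: E field_simps)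
    qed
    moreover have "(1 + \<rho>) * c \<le> 2 * (1 + \<rho>) * E" using E0 \<rho> c by (intro mult_mono) auto
    ultimately have "((1 + \<rho>) * c)\<^sup>2 \<le> D\<^sup>2" using \<rho> c by (intro power_mono) auto
    then have 1: "(1 + \<rho>)\<^sup>2 * c\<^sup>2 \<le> D\<^sup>2" by (simp add: power_mult_distrib)
    have 2: "real k * (1 + \<rho>) \<le> D\<^sup>2"
      using k \<rho> by (simp add: D2 algebra_simps)
    have "(1 + \<rho>) * M \<le> (1 + 1 / c\<^sup>2) * D\<^sup>2"
    proof (cases "\<rho> \<le> real k")
      case True
      then have "(1 + \<rho>) * M \<le> D\<^sup>2" using 2 by (simp add: M_def mult.commute)
      then show ?thesis by (simp add: distrib_right add_increasing2)
    next
      case False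
      then have "(1 + \<rho>) * M \<le> (1 + \<rho>)\<^sup>2" using \<rho> by (simp add: M_def power2_eq_square mult_left_mono)
      also have "\<dots> \<le> 1 / c\<^sup>2 * D\<^sup>2" using 1 c by (simp add: field_simps)
      finally show ?thesis by (simp add: distrib_right add_increasing)
    qed
    then show ?thesis using D M by (simp add: field_simps)
  qed
  then have "b \<le> sqrt ((1 + 1 / c\<^sup>2) / M)" unfolding b2[symmetric] by (rule real_le_rsqrt)
  then have "100 * (1 + C\<^sup>2) * b \<le> 100 * (1 + C\<^sup>2) * (sqrt (1 + 1 / c\<^sup>2) / sqrt M)"
    by (intro mult_left_mono) (auto simp: real_sqrt_divide)
  then have b\<epsilon>: "100 * (1 + C\<^sup>2) * b \<le> \<epsilon>" by (simp add: \<epsilon>_def M_def)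
  define R where "R = 26 * b + 18 * b * (m / D)\<^sup>2 + (1 / D\<^sup>2 + 18 * b / D\<^sup>2) * (4 * \<rho> * \<Delta>\<^sup>2)
    + 3 / (D^4 * b) * (16 * (2 * real k * \<rho>\<^sup>2 + 4 * \<rho>^3 * \<Delta>\<^sup>2 + m\<^sup>2))"
  have mD: "m / D\<^sup>2 = E / D" by (simp add: E power2_eq_square)
  have r1: "1 / D\<^sup>2 * (4 * \<rho> * \<Delta>\<^sup>2) \<le> (1 + C\<^sup>2) * b"
  proof -
    have "4 * \<rho> * \<Delta>\<^sup>2 \<le> 2 * m" using \<rho> by (simp add: m_def algebra_simps)
    then have "1 / D\<^sup>2 * (4 * \<rho> * \<Delta>\<^sup>2) \<le> 2 * (E * (1 / D))"
      using divide_right_mono[of "4 * \<rho> * \<Delta>\<^sup>2" "2 * m" "D\<^sup>2"] mD by simp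
    also have "\<dots> \<le> 2 * (C * b)" using E0 bD D by (intro mult_left_mono mult_mono) auto
    also have "\<dots> \<le> (1 + C\<^sup>2) * b"
      using mult_right_mono[of "2 * C" "1 + C\<^sup>2" b] zero_le_power2[of "C - 1"] b0
      by (simp add: power2_diff)
    finally show ?thesis .
  qed
  have r2: "18 * b / D\<^sup>2 * (4 * \<rho> * \<Delta>\<^sup>2) \<le> 18 * b"
  proof -
    have "4 * \<rho> * \<Delta>\<^sup>2 \<le> 4 * (1 + \<rho>)\<^sup>2 * \<Delta>\<^sup>2"
      using \<rho> by (intro mult_right_mono) (auto simp: power2_eq_square algebra_simps)
    also have "\<dots> \<le> D\<^sup>2" using k \<rho> by (simp add: D2)
    finally have "4 * \<rho> * \<Delta>\<^sup>2 / D\<^sup>2 \<le> 1" using D by simp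
    from mult_left_mono[OF this, of "18 * b"] show ?thesis using b0 by (simp add: mult_ac)
  qed
  \<comment> \<open>Both the variance of the noncentrality and the squared bias m^2 = E^2 D^2 are
    bounded by multiples of (1 + \<rho>) D^2 = b^2 D^4; division by D^4 b leaves one factor
    b.\<close>
  have r3: "3 / (D^4 * b) * (16 * (2 * real k * \<rho>\<^sup>2 + 4 * \<rho>^3 * \<Delta>\<^sup>2 + m\<^sup>2)) \<le> 48 * (1 + C\<^sup>2) * b"
  proof -
    have "2 * real k * \<rho>\<^sup>2 + 4 * \<rho>^3 * \<Delta>\<^sup>2 = \<rho> * (2 * real k * \<rho> + 4 * \<rho>\<^sup>2 * \<Delta>\<^sup>2)"
      by (simp add: power2_eq_square power3_eq_cube algebra_simps)
    also have "\<dots> \<le> \<rho> * D\<^sup>2"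
    proof (intro mult_left_mono \<rho>)
      have "2 * real k * \<rho> \<le> 2 * real k * (1 + 2 * \<rho>)" "4 * \<rho>\<^sup>2 * \<Delta>\<^sup>2 \<le> 4 * (1 + \<rho>)\<^sup>2 * \<Delta>\<^sup>2"
        using \<rho> by (auto intro!: mult_left_mono mult_right_mono power_mono)
      then show "2 * real k * \<rho> + 4 * \<rho>\<^sup>2 * \<Delta>\<^sup>2 \<le> D\<^sup>2" unfolding D2 by linarith
    qed
    also have "\<dots> \<le> (1 + \<rho>) * D\<^sup>2" by (intro mult_right_mono) auto
    finally have 1: "2 * real k * \<rho>\<^sup>2 + 4 * \<rho>^3 * \<Delta>\<^sup>2 \<le> (1 + \<rho>) * D\<^sup>2" .
    have "m\<^sup>2 = E\<^sup>2 * D\<^sup>2" using D by (simp add: E power_divide)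
    also have "\<dots> \<le> (C\<^sup>2 * (1 + \<rho>)) * D\<^sup>2"
      using E2 \<rho> mult_mono[of "E\<^sup>2" "C\<^sup>2" 1 "1 + \<rho>"] by (intro mult_right_mono) auto
    finally have "2 * real k * \<rho>\<^sup>2 + 4 * \<rho>^3 * \<Delta>\<^sup>2 + m\<^sup>2 \<le> (1 + C\<^sup>2) * ((1 + \<rho>) * D\<^sup>2)"
      using 1 by (simp add: algebra_simps)
    also have "(1 + \<rho>) * D\<^sup>2 = b\<^sup>2 * D^4" using D unfolding b2 by (simp add: power2_eq_square power4_eq_xxxx)
    finally have "3 / (D^4 * b) * (16 * (2 * real k * \<rho>\<^sup>2 + 4 * \<rho>^3 * \<Delta>\<^sup>2 + m\<^sup>2))
        \<le> 3 / (D^4 * b) * (16 * ((1 + C\<^sup>2) * (b\<^sup>2 * D^4)))"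
      using b0 by (intro mult_left_mono) auto
    also have "\<dots> = 48 * (1 + C\<^sup>2) * b" using b0 D by (simp add: power2_eq_square)
    finally show ?thesis .
  qed
  have "18 * b * (m / D)\<^sup>2 \<le> 18 * b * C\<^sup>2" using E2 b0 unfolding E by (intro mult_left_mono) auto
  \<comment> \<open>The pure b terms add up to 26 + 1 + 18 + 48 = 93 and those with C^2 to 18 + 1 +
    48 = 67, both below 100.\<close>
  then have "R \<le> 26 * b + 18 * b * C\<^sup>2 + ((1 + C\<^sup>2) * b + 18 * b) + 48 * (1 + C\<^sup>2) * b"
    unfolding R_def distrib_right[of "1 / D\<^sup>2"] using r1 r2 r3 by linarith
  also have "\<dots> \<le> 100 * (1 + C\<^sup>2) * b" using b0 by (simp add: algebra_simps)
  finally have R: "R \<le> \<epsilon>" using b\<epsilon> by linarith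
  have "6 * b \<le> 100 * (1 + C\<^sup>2) * b" using b0 by (simp add: algebra_simps add_increasing2)
  then have D\<epsilon>: "6 / D \<le> \<epsilon>" using bD b\<epsilon> by linarith
  have \<epsilon>: "\<epsilon> > 0" using less_le_trans[OF divide_pos_pos D\<epsilon>] D by simp
  note bounds = umm_pMD_bounds[OF k p \<Delta> \<rho>, folded m_def D_def, OF bD, folded R_def E E_def]
  show thesis
  proof (rule normal_curve_point_near[OF p _ _ \<epsilon>, of "1 - umm_pMD p \<Delta> \<rho> k" E])
    show "0 \<le> 1 - umm_pMD p \<Delta> \<rho> k" "1 - umm_pMD p \<Delta> \<rho> k \<le> 1" using bounds(3) by auto
    show "1 - umm_pMD p \<Delta> \<rho> k \<le> normal_tail (x - E) + \<epsilon>" if "p + \<epsilon> \<le> normal_tail x" for x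
      using bounds(1)[of x] that D\<epsilon> R by linarith
    show "normal_tail (x - E) - \<epsilon> \<le> 1 - umm_pMD p \<Delta> \<rho> k" if "normal_tail x \<le> p - \<epsilon>" for x
      using bounds(2)[of x] that D\<epsilon> R by linarith
  qed (use that in \<open>simp add: E_def\<close>)
qed

theorem theorem3:
  fixes \<Delta> \<rho> :: "nat \<Rightarrow> real" and k :: "nat \<Rightarrow> nat"
  assumes "\<And>m. \<Delta> m > 0" and "\<And>m. \<rho> m \<ge> 0" and "\<And>m. k m \<ge> 1"
    and "\<exists>c C. 0 < c \<and> (\<forall>m. c \<le> eff_snr (\<Delta> m) (\<rho> m) (k m) \<and> eff_snr (\<Delta> m) (\<rho> m) (k m) \<le> C)"
  shows "\<exists>\<psi> :: nat \<Rightarrow> real.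
    \<psi> \<in> O(\<lambda>m. 1 / sqrt (max (real (k m)) (\<rho> m))) \<and>
    (\<forall>pFA \<in> {0<..<1}. \<forall>m.
      \<exists>pFA' \<in> {0<..<1}. \<exists>pMD' \<in> {0<..<1}.
        normal_tail_inv pFA' + normal_tail_inv pMD' = eff_snr (\<Delta> m) (\<rho> m) (k m) \<and>
        max \<bar>pFA - pFA'\<bar> \<bar>umm_pMD pFA (\<Delta> m) (\<rho> m) (k m) - pMD'\<bar> \<le> \<psi> m)"
proof -
  obtain c C where c: "0 < c" and cC: "\<And>m. c \<le> eff_snr (\<Delta> m) (\<rho> m) (k m)"
      "\<And>m. eff_snr (\<Delta> m) (\<rho> m) (k m) \<le> C"
    using assms(4) by blast
  \<comment> \<open>K is built from c and C alone, so the rate is fixed before pFA is given.\<close>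
  define K where "K = 100 * (1 + C\<^sup>2) * sqrt (1 + 1 / c\<^sup>2)"
  define \<psi> where "\<psi> = (\<lambda>m. K / sqrt (max (real (k m)) (\<rho> m)))"
  have "\<psi> \<in> O(\<lambda>m. 1 / sqrt (max (real (k m)) (\<rho> m)))"
    unfolding \<psi>_def by (rule bigoI[where c="\<bar>K\<bar>"]) (simp add: abs_mult)
  moreover have "\<exists>pFA' \<in> {0<..<1}. \<exists>pMD' \<in> {0<..<1}.
        normal_tail_inv pFA' + normal_tail_inv pMD' = eff_snr (\<Delta> m) (\<rho> m) (k m) \<and>
        max \<bar>pFA - pFA'\<bar> \<bar>umm_pMD pFA (\<Delta> m) (\<rho> m) (k m) - pMD'\<bar> \<le> \<psi> m"
    if "pFA \<in> {0<..<1}" for pFA m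
  proof -
    have p: "0 < pFA" "pFA < 1" using that by auto
    let ?E = "eff_snr (\<Delta> m) (\<rho> m) (k m)"
    obtain x where x: "\<bar>normal_tail x - pFA\<bar> \<le> \<psi> m"
      "\<bar>normal_tail (x - ?E) - (1 - umm_pMD pFA (\<Delta> m) (\<rho> m) (k m))\<bar> \<le> \<psi> m"
      using umm_pMD_near_curve[OF assms(3) p assms(1,2) c cC] unfolding \<psi>_def K_def by blast
    \<comment> \<open>The point on the curve is (Q(x), Q(E - x)), with quantiles x and E - x summing
      to E; reflection turns the bound on the detection probability into one on the missed detection
      probability.\<close>
    have "normal_tail (?E - x) = 1 - normal_tail (x - ?E)"
      using normal_tail_uminus[of "x - ?E"] by simp
    then have "max \<bar>pFA - normal_tail x\<bar> \<bar>umm_pMD pFA (\<Delta> m) (\<rho> m) (k m) - normal_tail (?E - x)\<bar> \<le> \<psi> m"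
      using x by auto
    then show ?thesis
      by (intro bexI[of _ "normal_tail x"] bexI[of _ "normal_tail (?E - x)"] conjI)
        (simp_all add: normal_tail_inv_normal_tail normal_tail_bounds)
  qed
  ultimately show ?thesis by blast
qed

end
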